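(* (1) For every $\alpha\in(0,1)$ there exist constants $0<\lambda\le\Lambda<\infty$, $c>0$, $\rho>1$, a modulus of strict convexity $m$, and families, indexed by small $r>0$, of convex $C^{2,\alpha}$ functions $u_r:\mathbb R^2\to\mathbb R$ and of $C^\alpha$ functions $f_r:\mathbb R^2\to\mathbb R$ (with $\lambda,\Lambda,c,\rho,m$ independent of $r$) such that every $u_r$ has modulus of strict convexity $m$, $$\det D^2u_r=f_r\ \text{ in }\mathbb R^2,\qquad \lambda\le f_r\le\Lambda,\qquad \lim_{r\to0}\|f_r\|_{C^\alpha(B_1)}=\infty,$$ and $$\|D^2u_r\|_{C^\alpha(B_{1/2})}\ge c\,\|f_r\|_{C^\alpha(B_1)}^{\rho}.$$ (2) There exist constants $0<\lambda\le\Lambda<\infty$, $C>0$, $c>0$, a modulus of strict convexity $m$, and families, indexed by $\alpha\in(0,1/2]$, of convex $C^{2,\alpha}$ functions $u_\alpha:\mathbb R^2\to\mathbb R$ and of $C^\alpha$ functions $f_\alpha:\mathbb R^2\to\mathbb R$ (with $\lambda,\Lambda,C,c,m$ independent of $\alpha$) such that every $u_\alpha$ has modulus of strict convexity $m$, $$\det D^2u_\alpha=f_\alpha\ \text{ in }\mathbb R^2,\qquad \lambda\le f_\alpha\le\Lambda,\qquad \|f_\alpha\|_{C^\alpha(B_1)}\le C,$$ and $$\|D^2u_\alpha\|_{C^\alpha(B_{1/2})}\ge e^{c/\alpha}.$$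
   Context: $B_r\subset\mathbb R^2$ is the ball of radius $r$ centered at the origin. $\|f\|_{C^\alpha(E)}=\sup_E|f|+\sup_{x\ne y\in E}|f(x)-f(y)|/|x-y|^\alpha$; the same definition is used for matrix-valued functions. A $C^\alpha$ (resp. $C^{2,\alpha}$) function on $\mathbb R^2$ is one that is locally of that class, i.e. on every ball. A modulus of strict convexity is a nondecreasing function $m:(0,2)\to(0,\infty)$; a differentiable convex function $u$ has modulus of strict convexity $m$ if $u(z)\ge u(x)+\langle\nabla u(x),z-x\rangle+m(|z-x|)$ for all $x\ne z$ in $B_1$. *)

theory Defs
  imports "HOL-Analysis.Analysis"
begin

definition holder_quotients ::
    "real \<Rightarrow> ('a::real_normed_vector) set \<Rightarrow> ('a \<Rightarrow> 'b::real_normed_vector) \<Rightarrow> real set" where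
  "holder_quotients \<alpha> E f =
     {norm (f x - f y) / norm (x - y) powr \<alpha> | x y. x \<in> E \<and> y \<in> E \<and> x \<noteq> y}"

text \<open>The suprema are taken in the reals, so \<open>holder_norm \<alpha> E f\<close> is only meaningful when
  \<open>holder_on \<alpha> E f\<close> holds (finiteness of both suprema). For matrix-valued \<open>f\<close> the
  library norm on \<open>real^'n^'n\<close> is the Frobenius norm.\<close>

definition holder_norm ::
    "real \<Rightarrow> ('a::real_normed_vector) set \<Rightarrow> ('a \<Rightarrow> 'b::real_normed_vector) \<Rightarrow> real" where
  "holder_norm \<alpha> E f = (SUP x\<in>E. norm (f x)) + Sup (holder_quotients \<alpha> E f)"

definition holder_on ::
    "real \<Rightarrow> ('a::real_normed_vector) set \<Rightarrow> ('a \<Rightarrow> 'b::real_normed_vector) \<Rightarrow> bool" where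
  "holder_on \<alpha> E f \<longleftrightarrow>
     bdd_above ((\<lambda>x. norm (f x)) ` E) \<and> bdd_above (holder_quotients \<alpha> E f)"

definition C_alpha ::
    "real \<Rightarrow> ('a::real_normed_vector \<Rightarrow> 'b::real_normed_vector) \<Rightarrow> bool" where
  "C_alpha \<alpha> f \<longleftrightarrow> (\<forall>p R. R > 0 \<longrightarrow> holder_on \<alpha> (ball p R) f)"

definition gradient :: "(real^'n \<Rightarrow> real) \<Rightarrow> real^'n \<Rightarrow> real^'n" where
  "gradient u x = (\<chi> i. frechet_derivative u (at x) (axis i 1))"

lemma GDERIV_gradient:
  fixes u :: "real^'n \<Rightarrow> real"
  assumes "u differentiable (at x)"
  shows "GDERIV u x :> gradient u x"
proof -
  let ?D = "frechet_derivative u (at x)"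
  have D: "(u has_derivative ?D) (at x)"
    using assms by (simp add: frechet_derivative_works)
  then have lin: "linear ?D"
    by (rule has_derivative_linear)
  have "?D h = h \<bullet> gradient u x" for h
  proof -
    have "?D h = ?D (\<Sum>i\<in>UNIV. (h $ i) *\<^sub>R axis i 1)"
      using basis_expansion[of h] by (simp add: scalar_mult_eq_scaleR)
    also have "\<dots> = (\<Sum>i\<in>UNIV. h $ i * ?D (axis i 1))"
      by (simp add: linear_sum[OF lin] linear_scale[OF lin])
    finally show ?thesis
      by (simp add: inner_vec_def gradient_def)
  qed
  with D have "(u has_derivative (\<lambda>h. h \<bullet> gradient u x)) (at x)"
    by (metis (no_types, lifting) ext)
  then show ?thesis
    by (simp add: gderiv_def)
qed

definition hessian :: "(real^'n \<Rightarrow> real) \<Rightarrow> real^'n \<Rightarrow> real^'n^'n" where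
  "hessian u x = jacobian (gradient u) (at x)"

text \<open>For \<open>\<alpha> > 0\<close> the Hoelder condition makes the Hessian continuous, so \<open>u\<close> is
  twice continuously differentiable; bounds on \<open>u\<close> and its gradient on balls are then automatic.\<close>

definition C2_alpha :: "real \<Rightarrow> (real^'n \<Rightarrow> real) \<Rightarrow> bool" where
  "C2_alpha \<alpha> u \<longleftrightarrow>
     (\<forall>x. u differentiable (at x)) \<and> (\<forall>x. gradient u differentiable (at x)) \<and>
     C_alpha \<alpha> (hessian u)"

text \<open>A modulus is represented by a total function, of which only the values on the
  interval (0,2) matter.\<close>

definition convexity_modulus :: "(real \<Rightarrow> real) \<Rightarrow> bool" where
  "convexity_modulus m \<longleftrightarrow> mono_on {0<..<2} m \<and> (\<forall>t\<in>{0<..<2}. m t > 0)"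

definition has_convexity_modulus :: "(real^'n \<Rightarrow> real) \<Rightarrow> (real \<Rightarrow> real) \<Rightarrow> bool" where
  "has_convexity_modulus u m \<longleftrightarrow>
     (\<forall>x\<in>ball 0 1. \<forall>z\<in>ball 0 1. x \<noteq> z \<longrightarrow>
        u z \<ge> u x + gradient u x \<bullet> (z - x) + m (norm (z - x)))"

end

theory Submission
  imports Defs
begin

text \<open>
  For \<open>e > 0\<close> put \<open>g(a,b) = (a\<^sup>2 - b\<^sup>2) R\<close> with \<open>R = sqrt (a\<^sup>2 + b\<^sup>2 + e\<^sup>2)\<close>. This function is convex
  in \<open>a\<close> and concave in \<open>b\<close>, and both pure second derivatives have size between \<open>R\<close> and \<open>6 R\<close>.
  Its partial Legendre transform in the first variable, \<open>u(x,y) = max\<^sub>a (a x - g(a,y))\<close>, is therefore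
  convex, \<open>u\<^sub>x\<^sub>x = 1 / g\<^sub>a\<^sub>a\<close>, and \<open>det D\<^sup>2u = - g\<^sub>b\<^sub>b / g\<^sub>a\<^sub>a\<close> lies in \<open>[1/6, 6]\<close>. The bounds
  \<open>g\<^sub>a\<^sub>a \<ge> |a|\<close> and \<open>- g\<^sub>b\<^sub>b \<ge> |b|\<close> give a cubic modulus of strict convexity that does not depend
  on \<open>e\<close>. Since \<open>g\<close> scales with exponent 3, \<open>u\<close> lives near the origin on the scale \<open>e\<^sup>2\<close> in \<open>x\<close> and \<open>e\<close> in
  \<open>y\<close>, and \<open>u\<^sub>x\<^sub>x\<close> has size \<open>1/e\<close> there. Hence the \<open>C\<^sup>\<alpha>\<close> norm of the determinant is of order
  \<open>e\<close> to the power \<open>-2\<alpha>\<close>, while that of the Hessian is at least of order \<open>e\<close> to the power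
  \<open>-1-2\<alpha>\<close>. The first part is the choice \<open>e = r\<close>, the second one \<open>e = exp (-1/\<alpha>)\<close>.
\<close>

section \<open>The saddle function\<close>

definition rad :: "real \<Rightarrow> real \<Rightarrow> real \<Rightarrow> real" where
  "rad e a b = sqrt (a\<^sup>2 + b\<^sup>2 + e\<^sup>2)"

definition saddle :: "real \<Rightarrow> real \<Rightarrow> real \<Rightarrow> real" where
  "saddle e a b = (a\<^sup>2 - b\<^sup>2) * rad e a b"

text \<open>The partial derivative of \<open>saddle\<close> in \<open>a\<close>. As
  \<open>saddle\<close> is antisymmetric in its last two arguments, the partial derivative in
  \<open>b\<close> is \<open>- slope e b a\<close>. Likewise \<open>slope_d1 e a b\<close> and
  \<open>- slope_d1 e b a\<close> are the two pure second derivatives, and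
  \<open>slope_d2 e a b\<close> is the mixed one.\<close>

definition slope :: "real \<Rightarrow> real \<Rightarrow> real \<Rightarrow> real" where
  "slope e a b = a * (3 * a\<^sup>2 + b\<^sup>2 + 2 * e\<^sup>2) / rad e a b"

definition slope_num :: "real \<Rightarrow> real \<Rightarrow> real \<Rightarrow> real" where
  "slope_num e a b = 6 * (a\<^sup>2)\<^sup>2 + 9 * a\<^sup>2 * b\<^sup>2 + (b\<^sup>2)\<^sup>2 + e\<^sup>2 * (9 * a\<^sup>2 + 3 * b\<^sup>2) + 2 * (e\<^sup>2)\<^sup>2"

definition slope_d1 :: "real \<Rightarrow> real \<Rightarrow> real \<Rightarrow> real" where
  "slope_d1 e a b = slope_num e a b / rad e a b ^ 3"

definition slope_d2 :: "real \<Rightarrow> real \<Rightarrow> real \<Rightarrow> real" where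
  "slope_d2 e a b = a * b * (b\<^sup>2 - a\<^sup>2) / rad e a b ^ 3"

lemma rad_pos: "e > 0 \<Longrightarrow> rad e a b > 0"
  unfolding rad_def by (simp add: add_nonneg_pos)

lemma rad_squared: "(rad e a b)\<^sup>2 = a\<^sup>2 + b\<^sup>2 + e\<^sup>2"
  unfolding rad_def by simp

lemma rad_commute: "rad e b a = rad e a b"
  by (simp add: rad_def add.commute)

lemma saddle_swap: "saddle e b a = - saddle e a b"
  by (simp add: saddle_def rad_commute[of e b a] algebra_simps)

lemma slope_d2_swap: "slope_d2 e b a = - slope_d2 e a b"
  by (simp add: slope_d2_def rad_commute[of e b a] minus_divide_left algebra_simps del: minus_divide_left[symmetric])

text \<open>Stated with inner functions \<open>A\<close> and \<open>B\<close>, like the next two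
  rules, so that partial derivatives and derivatives along \<open>xi\<close> are both
  instances.\<close>

lemma has_derivative_rad:
  fixes A B :: "'v::real_normed_vector \<Rightarrow> real"
  assumes e: "e > 0"
    and A: "(A has_derivative A') (at p within S)" and B: "(B has_derivative B') (at p within S)"
  shows "((\<lambda>p. rad e (A p) (B p)) has_derivative
           (\<lambda>h. (A p * A' h + B p * B' h) / rad e (A p) (B p))) (at p within S)"
proof -
  have pos: "(A p)\<^sup>2 + (B p)\<^sup>2 + e\<^sup>2 > 0"
    using e by (simp add: add_nonneg_pos)
  show ?thesis
    unfolding rad_def
    using pos by (auto intro!: derivative_eq_intros A B simp: field_simps)
qed

lemma has_derivative_saddle:
  fixes A B :: "'v::real_normed_vector \<Rightarrow> real"
  assumes e: "e > 0"
    and A: "(A has_derivative A') (at p within S)" and B: "(B has_derivative B') (at p within S)"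
  shows "((\<lambda>p. saddle e (A p) (B p)) has_derivative
           (\<lambda>h. slope e (A p) (B p) * A' h - slope e (B p) (A p) * B' h)) (at p within S)"
proof -
  let ?R = "rad e (A p) (B p)"
  \<comment> \<open>Eliminating the square of \<open>e\<close> in favour of the radius leaves a
    rational identity in \<open>A p\<close>, \<open>B p\<close> and \<open>?R\<close> as independent
    quantities.\<close>
  have e2: "e\<^sup>2 = ?R\<^sup>2 - (A p)\<^sup>2 - (B p)\<^sup>2" by (simp add: rad_squared)
  have R: "?R > 0" using e by (rule rad_pos)
  show ?thesis
    unfolding saddle_def slope_def rad_commute[of e "B p"] e2
    apply (rule has_derivative_eq_rhs)
     apply (rule derivative_intros has_derivative_rad[OF e] A B)+
    using R by (auto simp: field_simps power2_eq_square)
qed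

lemma has_derivative_slope:
  fixes A B :: "'v::real_normed_vector \<Rightarrow> real"
  assumes e: "e > 0"
    and A: "(A has_derivative A') (at p within S)" and B: "(B has_derivative B') (at p within S)"
  shows "((\<lambda>p. slope e (A p) (B p)) has_derivative
           (\<lambda>h. slope_d1 e (A p) (B p) * A' h + slope_d2 e (A p) (B p) * B' h)) (at p within S)"
proof -
  let ?R = "rad e (A p) (B p)"
  have e2: "e\<^sup>2 = ?R\<^sup>2 - (A p)\<^sup>2 - (B p)\<^sup>2" by (simp add: rad_squared)
  have R: "?R > 0" using e by (rule rad_pos)
  show ?thesis
    unfolding slope_def
    apply (rule has_derivative_eq_rhs)
     apply (rule derivative_intros has_derivative_rad[OF e] A B)+
    subgoal using R by simp
    unfolding slope_d1_def slope_d2_def slope_num_def e2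
    using R by (auto simp: field_simps power2_eq_square power3_eq_cube)
qed

text \<open>Both polynomials are compared monomial by monomial in a^2, b^2, e^2: each coefficient of
  \<open>slope_num\<close> lies between one and six times that of (a^2 + b^2 + e^2)^2.\<close>

lemma slope_num_bounds:
  "rad e a b ^ 4 \<le> slope_num e a b" "slope_num e a b \<le> 6 * rad e a b ^ 4"
proof -
  have R4: "rad e a b ^ 4 = (a\<^sup>2 + b\<^sup>2 + e\<^sup>2)\<^sup>2"
    by (simp add: rad_squared[symmetric] power_mult[symmetric])
  have *: "0 \<le> (a\<^sup>2)\<^sup>2" "0 \<le> (b\<^sup>2)\<^sup>2" "0 \<le> (e\<^sup>2)\<^sup>2" "0 \<le> a\<^sup>2 * b\<^sup>2" "0 \<le> a\<^sup>2 * e\<^sup>2" "0 \<le> b\<^sup>2 * e\<^sup>2"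
    by simp_all
  have **: "(a\<^sup>2 + b\<^sup>2 + e\<^sup>2)\<^sup>2 =
     (a\<^sup>2)\<^sup>2 + (b\<^sup>2)\<^sup>2 + (e\<^sup>2)\<^sup>2 + 2 * (a\<^sup>2 * b\<^sup>2) + 2 * (a\<^sup>2 * e\<^sup>2) + 2 * (b\<^sup>2 * e\<^sup>2)"
    by (simp add: power2_eq_square algebra_simps)
  have n: "slope_num e a b = 6 * (a\<^sup>2)\<^sup>2 + 9 * (a\<^sup>2 * b\<^sup>2) + (b\<^sup>2)\<^sup>2 + 9 * (a\<^sup>2 * e\<^sup>2)
      + 3 * (b\<^sup>2 * e\<^sup>2) + 2 * (e\<^sup>2)\<^sup>2"
    by (simp add: slope_num_def algebra_simps)
  show "rad e a b ^ 4 \<le> slope_num e a b" "slope_num e a b \<le> 6 * rad e a b ^ 4"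
    unfolding R4 ** n distrib_left by (insert *, linarith)+
qed

lemma slope_d1_bounds:
  assumes "e > 0"
  shows "rad e a b \<le> slope_d1 e a b" "slope_d1 e a b \<le> 6 * rad e a b"
  using slope_num_bounds[of e a b] rad_pos[OF assms, of a b]
  by (simp_all add: slope_d1_def field_simps power_numeral_reduce)

lemma rad_bounds:
  assumes "e > 0"
  shows "\<bar>a\<bar> \<le> rad e a b" "\<bar>b\<bar> \<le> rad e a b" "e \<le> rad e a b"
  using assms by (auto simp: rad_def intro!: real_le_rsqrt)

lemma slope_d1_pos: "e > 0 \<Longrightarrow> slope_d1 e a b > 0"
  using slope_d1_bounds(1)[of e a b] rad_pos[of e a b] by linarith

text \<open>The radius is also a lower bound for \<open>slope_d1\<close>, so the quotient of
  \<open>slope_d2\<close> by \<open>slope_d1\<close> stays in [-1, 1].\<close>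

lemma abs_slope_d2_le:
  assumes e: "e > 0"
  shows "\<bar>slope_d2 e a b\<bar> \<le> rad e a b"
proof -
  let ?R = "rad e a b"
  have R: "?R > 0" using e by (rule rad_pos)
  have "\<bar>a\<bar> * \<bar>b\<bar> \<le> ?R * ?R"
    using rad_bounds(1,2)[OF e] rad_pos[OF e, of a b] by (intro mult_mono) (auto simp: less_imp_le)
  moreover have "\<bar>b\<^sup>2 - a\<^sup>2\<bar> \<le> ?R\<^sup>2"
    unfolding rad_squared abs_le_iff by (auto intro: order_trans[of _ 0])
  ultimately have "\<bar>a\<bar> * \<bar>b\<bar> * \<bar>b\<^sup>2 - a\<^sup>2\<bar> \<le> (?R * ?R) * ?R\<^sup>2"
    by (rule mult_mono) auto
  also have "\<dots> = ?R * ?R ^ 3" by (simp add: power2_eq_square power3_eq_cube)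
  finally show ?thesis
    using R by (simp add: slope_d2_def abs_mult abs_divide pos_divide_le_eq)
qed

lemma DERIV_slope_1:
  assumes "e > 0"
  shows "((\<lambda>t. slope e t b) has_real_derivative slope_d1 e t b) (at t)"
  using has_derivative_slope[OF assms has_derivative_ident has_derivative_const, of b t UNIV]
  by (simp add: has_field_derivative_def)

lemma DERIV_slope_2:
  assumes "e > 0"
  shows "((\<lambda>t. slope e a t) has_real_derivative slope_d2 e a t) (at t)"
  using has_derivative_slope[OF assms has_derivative_const has_derivative_ident, of a t UNIV]
  by (simp add: has_field_derivative_def)

lemma DERIV_saddle:
  assumes "e > 0"
  shows "((\<lambda>t. saddle e t b) has_real_derivative slope e t b) (at t)"
  using has_derivative_saddle[OF assms has_derivative_ident has_derivative_const, of b t UNIV]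
  by (simp add: has_field_derivative_def)

section \<open>Cubic lower bounds for Bregman distances\<close>

lemma DERIV_mult_abs: "((\<lambda>t::real. t * \<bar>t\<bar>) has_real_derivative 2 * \<bar>t\<bar>) (at t)"
proof -
  consider "t = 0" | "t > 0" | "t < 0" by linarith
  then show ?thesis
  proof cases
    case 1
    have "((\<lambda>h::real. \<bar>h\<bar>) \<longlongrightarrow> 0) (at 0)"
      by (rule tendsto_eq_intros refl)+ simp
    then have "((\<lambda>h::real. h * \<bar>h\<bar> / h) \<longlongrightarrow> 0) (at 0)"
      by (rule Lim_transform_eventually) (auto simp: eventually_at_filter)
    then show ?thesis using 1 by (simp add: DERIV_def)
  next
    case 2
    have "((\<lambda>t. t * t) has_real_derivative 2 * \<bar>t\<bar>) (at t)"
      using 2 by (auto intro!: derivative_eq_intros)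
    then show ?thesis
      by (rule has_field_derivative_transform_within_open[where S="{0<..}"]) (use 2 in auto)
  next
    case 3
    have "((\<lambda>t. - (t * t)) has_real_derivative 2 * \<bar>t\<bar>) (at t)"
      using 3 by (auto intro!: derivative_eq_intros)
    then show ?thesis
      by (rule has_field_derivative_transform_within_open[where S="{..<0}"]) (use 3 in auto)
  qed
qed

lemma DERIV_cube_abs: "((\<lambda>t::real. t * (t * \<bar>t\<bar>)) has_real_derivative 3 * (t * \<bar>t\<bar>)) (at t)"
  using DERIV_mult[OF DERIV_ident DERIV_mult_abs, of t] by (simp add: algebra_simps)

text \<open>This concerns the function |t|^3. Changing both signs reduces it to a nonnegative base
  point x; for y >= 0 the remainder factors as (y - x)^2 (y + 2x).\<close>

lemma cubic_bregman:
  fixes a b :: real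
  shows "b * (b * \<bar>b\<bar>) \<ge> a * (a * \<bar>a\<bar>) + 3 * (a * \<bar>a\<bar>) * (b - a) + \<bar>b - a\<bar> ^ 3 / 2"
proof -
  have main: "y * (y * \<bar>y\<bar>) \<ge> x * (x * \<bar>x\<bar>) + 3 * (x * \<bar>x\<bar>) * (y - x) + \<bar>y - x\<bar> ^ 3 / 2"
    if x: "x \<ge> 0" for x y :: real
  proof (cases "y \<ge> 0")
    case True
    have eq: "y ^ 3 - x ^ 3 - 3 * x\<^sup>2 * (y - x) = (y - x)\<^sup>2 * (y + 2 * x)"
      by (simp add: power2_eq_square power3_eq_cube algebra_simps)
    have "(y - x)\<^sup>2 * (\<bar>y - x\<bar> / 2) \<le> (y - x)\<^sup>2 * (y + 2 * x)"
      using x True by (intro mult_left_mono) auto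
    moreover have "\<bar>y - x\<bar> ^ 3 = (y - x)\<^sup>2 * \<bar>y - x\<bar>"
      by (simp add: power3_eq_cube power2_eq_square abs_mult_self_eq)
    ultimately show ?thesis
      using eq x True
      by (simp add: power2_eq_square[of x] power3_eq_cube[of x] power3_eq_cube[of y])
  next
    case False
    define t where "t = - y"
    have t: "t > 0" "y = - t" using False by (auto simp: t_def)
    have "(- x) ^ 3 \<le> (t - x) ^ 3"
      using t x by (intro power_mono_odd) auto
    moreover have "x ^ 3 \<ge> 0" using x by simp
    \<comment> \<open>Twice the difference of the two sides of the claim is (t - x)^3 + 4
      x^3.\<close>
    ultimately have "(t - x) ^ 3 + 4 * x ^ 3 \<ge> 0" unfolding power3_eq_cube[of "- x"] power3_eq_cube[of x] by simp
    moreover have "\<bar>y - x\<bar> = t + x" "\<bar>y\<bar> = t" "\<bar>x\<bar> = x" using t x by auto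
    ultimately show ?thesis
      using t by (simp add: power3_eq_cube algebra_simps)
  qed
  show ?thesis
  proof (cases "a \<ge> 0")
    case True then show ?thesis by (rule main)
  next
    case False
    then have "- a \<ge> 0" by simp
    from main[OF this, of "- b"] show ?thesis
      by (simp add: algebra_simps abs_minus_commute)
  qed
qed

text \<open>The second derivative of |t|^3 / 6 is |t|, which \<open>slope_d1\<close> dominates. So
  \<open>saddle\<close> minus this cubic is convex in the first argument and lies above its
  tangents; one sixth of \<open>cubic_bregman\<close> supplies the remainder.\<close>

lemma saddle_bregman:
  assumes e: "e > 0"
  shows "saddle e t b \<ge> saddle e s b + slope e s b * (t - s) + \<bar>t - s\<bar> ^ 3 / 12"
proof -
  define F where "F = (\<lambda>t. saddle e t b - t * (t * \<bar>t\<bar>) / 6)"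
  define F' where "F' = (\<lambda>t. slope e t b - t * \<bar>t\<bar> / 2)"
  have F: "(F has_real_derivative F' x) (at x)" for x
    unfolding F_def F'_def
    using DERIV_diff[OF DERIV_saddle[OF e] DERIV_cdivide[OF DERIV_cube_abs], of b 6 x] by simp
  have F': "(F' has_real_derivative slope_d1 e x b - \<bar>x\<bar>) (at x)" for x
    unfolding F'_def
    using DERIV_diff[OF DERIV_slope_1[OF e] DERIV_cdivide[OF DERIV_mult_abs], of b 2 x] by simp
  have "slope_d1 e x b - \<bar>x\<bar> \<ge> 0" for x
    using slope_d1_bounds(1)[OF e, of x b] rad_bounds(1)[OF e, of x b] by linarith
  with F F' have "convex_on UNIV F"
    by (intro f''_ge0_imp_convex[where f'=F']) auto
  from convex_on_imp_above_tangent[OF this, of s t "F' s"] F[of s]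
  have "F t - F s \<ge> F' s * (t - s)" by simp
  then show ?thesis
    using cubic_bregman[of s t] unfolding F_def F'_def
    by (simp add: algebra_simps diff_divide_distrib)
qed

section \<open>The partial Legendre transform\<close>

lemma slope_zero [simp]: "slope e 0 b = 0"
  by (simp add: slope_def)

lemma slope_minus: "slope e (- a) b = - slope e a b"
  by (simp add: slope_def rad_def minus_divide_left[symmetric])

text \<open>Mean value theorem with \<open>slope_d1\<close> >= \<open>rad\<close> >=
  \<open>e\<close>. The estimate yields unique solvability of the equation defining
  \<open>xi\<close> and also the continuity of \<open>xi\<close>.\<close>

lemma slope_expanding:
  assumes e: "e > 0"
  shows "e * \<bar>s - t\<bar> \<le> \<bar>slope e s b - slope e t b\<bar>"
proof -
  have lt: "e * (t - s) \<le> slope e t b - slope e s b" if "s < t" for s t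
  proof -
    obtain z where "slope e t b - slope e s b = (t - s) * slope_d1 e z b"
      using MVT2[OF \<open>s < t\<close>, of "\<lambda>t. slope e t b" "\<lambda>t. slope_d1 e t b"] DERIV_slope_1[OF e] by auto
    moreover have "e \<le> slope_d1 e z b"
      using rad_bounds(3)[OF e, where a = z and b = b] slope_d1_bounds(1)[OF e, of z b] by linarith
    ultimately show ?thesis
      using that by (simp add: mult.commute)
  qed
  show ?thesis
    using lt[of s t] lt[of t s] by (cases s t rule: linorder_cases) auto
qed

lemma slope_solvable:
  assumes e: "e > 0"
  shows "\<exists>!a. slope e a b = x"
proof -
  have cont: "continuous_on S (\<lambda>t. slope e t b)" for S
    by (intro continuous_at_imp_continuous_on ballI DERIV_isCont[OF DERIV_slope_1[OF e]])
  have pos: "\<exists>a. slope e a b = x" if x: "x \<ge> 0" for x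
  proof -
    \<comment> \<open>By expansion \<open>slope\<close> grows from 0 to at least \<open>x\<close> on
      the interval from 0 to \<open>x / e\<close>, so the intermediate value theorem applies there.
      Negative values follow by oddness.\<close>
    have "e * \<bar>x / e\<bar> \<le> \<bar>slope e (x / e) b\<bar>"
      using slope_expanding[OF e, of "x / e" 0 b] by simp
    moreover have "slope e (x / e) b \<ge> 0"
      using e x rad_pos[OF e, of "x / e" b] by (simp add: slope_def)
    ultimately have "x \<le> slope e (x / e) b" using e x by simp
    then show ?thesis
      using IVT'[of "\<lambda>t. slope e t b" 0 x "x / e"] e x cont by auto
  qed
  have "\<exists>a. slope e a b = x"
    using pos[of x] pos[of "- x"] slope_minus[of e _ b] by (metis linear minus_minus neg_0_le_iff_le)
  moreover have "s = t" if "slope e s b = slope e t b" for s t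
    using slope_expanding[OF e, of s t b] that e by (simp add: mult_le_0_iff)
  ultimately show ?thesis by metis
qed

text \<open>The maximising \<open>a\<close> in the Legendre transform, that is, the first component of the gradient of the
  potential.\<close>

definition xi :: "real \<Rightarrow> real^2 \<Rightarrow> real" where
  "xi e p = (THE a. slope e a (p $ 2) = p $ 1)"

lemma slope_xi: "e > 0 \<Longrightarrow> slope e (xi e p) (p $ 2) = p $ 1"
  unfolding xi_def by (rule theI') (rule slope_solvable)

lemma xi_eqI: "e > 0 \<Longrightarrow> slope e a (p $ 2) = p $ 1 \<Longrightarrow> xi e p = a"
  using slope_solvable[of e "p $ 2" "p $ 1"] slope_xi[of e p] by blast

lemma vector_2_eq: "(vector [a, b] :: real^2) = a *\<^sub>R axis 1 1 + b *\<^sub>R axis 2 1"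
  by (simp add: vec_eq_iff forall_2 axis_def)

lemma has_derivative_vector_2:
  assumes "(F has_derivative F') (at p within S)" "(G has_derivative G') (at p within S)"
  shows "((\<lambda>p. vector [F p, G p] :: real^2) has_derivative (\<lambda>h. vector [F' h, G' h])) (at p within S)"
  unfolding vector_2_eq by (intro derivative_intros assms)

lemma has_derivative_vec_nth: "((\<lambda>p. p $ i) has_derivative (\<lambda>h. h $ i)) (at p within S)"
  by (rule bounded_linear_imp_has_derivative) (rule bounded_linear_vec_nth)

text \<open>The inverse function rule applied next asks for continuity beforehand. The two values of
  \<open>xi\<close> are compared at the common height \<open>q $ 2\<close>, where
  \<open>slope\<close> equals \<open>q $ 1\<close> at \<open>xi e q\<close>.\<close>

lemma continuous_xi:
  assumes e: "e > 0"
  shows "isCont (xi e) p"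
proof -
  have "((\<lambda>q. slope e (xi e p) (q $ 2) - q $ 1) \<longlongrightarrow> slope e (xi e p) (p $ 2) - p $ 1) (at p)"
    by (intro tendsto_intros isCont_tendsto_compose[OF DERIV_isCont[OF DERIV_slope_2[OF e]]])
  then have "((\<lambda>q. \<bar>slope e (xi e p) (q $ 2) - q $ 1\<bar> / e) \<longlongrightarrow> 0) (at p)"
    using tendsto_divide_zero[OF tendsto_rabs_zero] slope_xi[OF e, of p] by simp
  then show ?thesis
    unfolding isCont_def LIM_zero_iff[of "xi e", symmetric]
  proof (rule Lim_null_comparison[rotated], intro always_eventually allI)
    fix q
    show "norm (xi e q - xi e p) \<le> \<bar>slope e (xi e p) (q $ 2) - q $ 1\<bar> / e"
      using slope_expanding[OF e, of "xi e p" "xi e q" "q $ 2"] slope_xi[OF e, of q] e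
      by (simp add: field_simps abs_minus_commute)
  qed
qed

text \<open>\<open>xi\<close> is the first component of \<open>H\<close>, a right inverse of the map
  \<open>F\<close> taking (a, b) to (\<open>slope e a b\<close>, b). The derivative of
  \<open>F\<close> is triangular, so its inverse is explicit.\<close>

lemma has_derivative_xi:
  assumes e: "e > 0"
  shows "(xi e has_derivative
    (\<lambda>h. (h $ 1 - slope_d2 e (xi e p) (p $ 2) * h $ 2) / slope_d1 e (xi e p) (p $ 2))) (at p)"
proof -
  define a b where "a = xi e p" and "b = p $ 2"
  define F where "F = (\<lambda>q::real^2. vector [slope e (q $ 1) (q $ 2), q $ 2] :: real^2)"
  define H where "H = (\<lambda>q::real^2. vector [xi e q, q $ 2] :: real^2)"
  have d1: "slope_d1 e a b \<noteq> 0" using slope_d1_pos[OF e, of a b] by simp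
  have "(F has_derivative
      (\<lambda>h. vector [slope_d1 e a b * h $ 1 + slope_d2 e a b * h $ 2, h $ 2])) (at (H p))"
    unfolding F_def
    using has_derivative_vector_2[OF has_derivative_slope[OF e has_derivative_vec_nth[of 1] has_derivative_vec_nth[of 2]]
        has_derivative_vec_nth[of 2], where p = "H p" and S = UNIV]
    by (simp add: H_def a_def b_def)
  moreover have "bounded_linear
      (\<lambda>h::real^2. vector [(h $ 1 - slope_d2 e a b * h $ 2) / slope_d1 e a b, h $ 2] :: real^2)"
    unfolding vector_2_eq
    by (intro bounded_linear_add bounded_linear_scaleR_const bounded_linear_divide
        bounded_linear_compose[OF bounded_linear_divide] bounded_linear_sub
        bounded_linear_const_mult bounded_linear_vec_nth)
  moreover have "(\<lambda>h::real^2. vector [(h $ 1 - slope_d2 e a b * h $ 2) / slope_d1 e a b, h $ 2] :: real^2) \<circ>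
      (\<lambda>h::real^2. vector [slope_d1 e a b * h $ 1 + slope_d2 e a b * h $ 2, h $ 2]) = id"
    using d1 by (auto simp: fun_eq_iff vec_eq_iff forall_2)
  moreover have "continuous (at p) H"
    unfolding H_def vector_2_eq by (intro continuous_intros continuous_xi[OF e])
  moreover have "F (H q) = q" for q
    by (simp add: F_def H_def slope_xi[OF e] vec_eq_iff forall_2)
  ultimately have "(H has_derivative
      (\<lambda>h. vector [(h $ 1 - slope_d2 e a b * h $ 2) / slope_d1 e a b, h $ 2])) (at p)"
    by (rule has_derivative_inverse_basic[OF _ _ _ _ open_UNIV UNIV_I])
  from has_derivative_compose[OF this has_derivative_vec_nth, of 1]
  show ?thesis by (simp add: H_def a_def b_def)
qed

text \<open>The partial derivatives of \<open>xi\<close> are at most 1/e and 1 in absolute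
  value.\<close>

lemma xi_lipschitz:
  assumes e: "e > 0"
  shows "\<bar>xi e p - xi e q\<bar> \<le> (1 / e + 1) * norm (p - q)"
proof -
  have "onorm (\<lambda>h::real^2. (h $ 1 - slope_d2 e (xi e p) (p $ 2) * h $ 2) / slope_d1 e (xi e p) (p $ 2))
      \<le> 1 / e + 1" (is "onorm ?D \<le> _") for p
  proof (rule onorm_bound)
    show "0 \<le> 1 / e + 1" using e by simp
    fix h :: "real^2"
    let ?a = "xi e p" and ?b = "p $ 2"
    let ?d = "slope_d1 e ?a ?b"
    have d: "?d > 0" "e \<le> ?d" "\<bar>slope_d2 e ?a ?b\<bar> \<le> ?d"
      using slope_d1_pos[OF e, of ?a ?b] slope_d1_bounds(1)[OF e, of ?a ?b]
        rad_bounds(3)[OF e, where a = ?a and b = ?b] abs_slope_d2_le[OF e, of ?a ?b] by linarith+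
    have "norm (?D h) \<le> (\<bar>h $ 1\<bar> + \<bar>slope_d2 e ?a ?b\<bar> * \<bar>h $ 2\<bar>) / ?d"
      using d(1) by (auto simp: abs_divide abs_mult[symmetric] intro!: divide_right_mono)
    also have "\<dots> = \<bar>h $ 1\<bar> / ?d + \<bar>slope_d2 e ?a ?b\<bar> / ?d * \<bar>h $ 2\<bar>"
      by (simp add: add_divide_distrib)
    also have "\<dots> \<le> norm h / e + 1 * norm h"
      using d e component_le_norm_cart[of h 1] component_le_norm_cart[of h 2]
      by (intro add_mono frac_le mult_mono) auto
    finally show "norm (?D h) \<le> (1 / e + 1) * norm h" by (simp add: algebra_simps)
  qed
  then have "norm (xi e p - xi e q) \<le> (1 / e + 1) * norm (p - q)"
    by (intro differentiable_bound[OF convex_UNIV has_derivative_xi[OF e]]) auto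
  then show ?thesis by simp
qed

section \<open>The potential, its derivatives and its convexity\<close>

definition potential :: "real \<Rightarrow> real^2 \<Rightarrow> real" where
  "potential e p = xi e p * p $ 1 - saddle e (xi e p) (p $ 2)"

definition source :: "real \<Rightarrow> real^2 \<Rightarrow> real" where
  "source e p = slope_d1 e (p $ 2) (xi e p) / slope_d1 e (xi e p) (p $ 2)"

text \<open>Envelope principle: the terms containing the derivative of \<open>xi\<close> cancel,
  because \<open>slope\<close> at \<open>xi e p\<close> equals \<open>p $ 1\<close>.\<close>

lemma has_derivative_potential:
  assumes e: "e > 0"
  shows "(potential e has_derivative (\<lambda>h. xi e p * h $ 1 + slope e (p $ 2) (xi e p) * h $ 2)) (at p)"
  unfolding potential_def[abs_def]
  apply (rule has_derivative_eq_rhs)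
   apply (rule derivative_intros has_derivative_saddle[OF e] has_derivative_xi[OF e] has_derivative_vec_nth)+
  by (simp add: fun_eq_iff slope_xi[OF e] algebra_simps)

lemma gradient_eqI:
  fixes u :: "real^2 \<Rightarrow> real"
  assumes "(u has_derivative (\<lambda>h. a * h $ 1 + b * h $ 2)) (at p)"
  shows "gradient u p = vector [a, b]"
  using frechet_derivative_at[OF assms, symmetric] by (simp add: gradient_def vec_eq_iff forall_2 axis_def)

lemma gradient_potential:
  "e > 0 \<Longrightarrow> gradient (potential e) = (\<lambda>p. vector [xi e p, slope e (p $ 2) (xi e p)])"
  by (rule ext) (rule gradient_eqI[OF has_derivative_potential])

lemma has_derivative_gradient_potential:
  fixes p :: "real^2"
  assumes e: "e > 0"
  defines "a \<equiv> xi e p" and "b \<equiv> p $ 2"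
  shows "(gradient (potential e) has_derivative
    (\<lambda>h. vector [(h $ 1 - slope_d2 e a b * h $ 2) / slope_d1 e a b,
       slope_d1 e b a * h $ 2 - slope_d2 e a b * ((h $ 1 - slope_d2 e a b * h $ 2) / slope_d1 e a b)])) (at p)"
  unfolding gradient_potential[OF e]
  apply (rule has_derivative_eq_rhs)
   apply (rule has_derivative_vector_2 has_derivative_slope[OF e] has_derivative_xi[OF e] has_derivative_vec_nth)+
  by (simp add: a_def b_def slope_d2_swap[of e "p $ 2" "xi e p"])

lemma hessian_potential:
  fixes p :: "real^2"
  assumes e: "e > 0"
  defines "a \<equiv> xi e p" and "b \<equiv> p $ 2"
  shows "hessian (potential e) p $ 1 $ 1 = 1 / slope_d1 e a b"
    "hessian (potential e) p $ 1 $ 2 = - slope_d2 e a b / slope_d1 e a b"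
    "hessian (potential e) p $ 2 $ 1 = - slope_d2 e a b / slope_d1 e a b"
    "hessian (potential e) p $ 2 $ 2 = slope_d1 e b a + (slope_d2 e a b)\<^sup>2 / slope_d1 e a b"
  using frechet_derivative_at[OF has_derivative_gradient_potential[OF e, of p], symmetric]
  by (simp_all add: hessian_def jacobian_def matrix_def axis_def a_def b_def power2_eq_square)

text \<open>The square of the mixed derivative cancels, leaving the quotient of the two pure second
  derivatives of \<open>saddle\<close>, up to sign.\<close>

lemma det_hessian_potential:
  assumes e: "e > 0"
  shows "det (hessian (potential e) p) = source e p"
  using slope_d1_pos[OF e, of "xi e p" "p $ 2"]
  by (simp add: det_2 hessian_potential[OF e] source_def field_simps power2_eq_square)

text \<open>Numerator and denominator both lie between R and 6 R with the same R, since
  \<open>rad\<close> is symmetric in its last two arguments.\<close>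

lemma source_bounds:
  assumes e: "e > 0"
  shows "1 / 6 \<le> source e p" "source e p \<le> 6"
  using slope_d1_bounds[OF e, of "xi e p" "p $ 2"] slope_d1_bounds[OF e, of "p $ 2" "xi e p"]
    slope_d1_pos[OF e, of "xi e p" "p $ 2"] rad_commute[of e "xi e p" "p $ 2"]
  by (simp_all add: source_def field_simps)

text \<open>Two applications of \<open>saddle_bregman\<close>. At fixed \<open>q $ 2\<close>,
  replacing the maximiser \<open>xi e q\<close> by \<open>xi e p\<close> lowers the Legendre
  expression by at least a cubic amount; at fixed \<open>xi e p\<close>, concavity of
  \<open>saddle\<close> in its second variable handles the passage from \<open>p $ 2\<close> to
  \<open>q $ 2\<close>.\<close>

lemma potential_bregman:
  assumes e: "e > 0"
  shows "potential e p + gradient (potential e) p \<bullet> (q - p)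
      + (\<bar>xi e q - xi e p\<bar> ^ 3 + \<bar>q $ 2 - p $ 2\<bar> ^ 3) / 12 \<le> potential e q"
  using saddle_bregman[OF e, of "xi e q" "q $ 2" "xi e p"] saddle_bregman[OF e, of "p $ 2" "xi e p" "q $ 2"]
    saddle_swap[of e "p $ 2" "xi e p"] saddle_swap[of e "q $ 2" "xi e p"]
  by (simp add: gradient_potential[OF e] potential_def inner_vec_def sum_2 slope_xi[OF e]
      abs_minus_commute algebra_simps add_divide_distrib)

text \<open>Averaging the two inequalities based at the intermediate point makes the linear terms
  cancel.\<close>

lemma convex_on_if_above_tangents:
  fixes u :: "'a::real_inner \<Rightarrow> real"
  assumes "\<And>p q. u p + D p \<bullet> (q - p) \<le> u q"
  shows "convex_on UNIV u"
proof (rule convex_onI)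
  fix t :: real and x y :: 'a
  assume t: "0 < t" "t < 1"
  let ?z = "(1 - t) *\<^sub>R x + t *\<^sub>R y"
  have "(1 - t) * (u ?z + D ?z \<bullet> (x - ?z)) + t * (u ?z + D ?z \<bullet> (y - ?z)) \<le> (1 - t) * u x + t * u y"
    using t by (intro add_mono mult_left_mono assms) auto
  moreover have "(1 - t) * (u ?z + D ?z \<bullet> (x - ?z)) + t * (u ?z + D ?z \<bullet> (y - ?z))
     = u ?z + D ?z \<bullet> ((1 - t) *\<^sub>R (x - ?z) + t *\<^sub>R (y - ?z))"
    by (simp add: inner_add_right inner_diff_right algebra_simps)
  moreover have "(1 - t) *\<^sub>R (x - ?z) + t *\<^sub>R (y - ?z) = 0"
    by (simp add: algebra_simps)
  ultimately show "u ?z \<le> (1 - t) * u x + t * u y" by simp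
qed simp

lemma convex_potential:
  assumes e: "e > 0"
  shows "convex_on UNIV (potential e)"
proof (rule convex_on_if_above_tangents)
  show "potential e p + gradient (potential e) p \<bullet> (q - p) \<le> potential e q" for p q
    by (rule order_trans[OF _ potential_bregman[OF e, of p q]]) simp
qed

section \<open>Strict convexity\<close>

lemma norm_le_abs_2: "norm (v :: real^2) \<le> \<bar>v $ 1\<bar> + \<bar>v $ 2\<bar>"
  using norm_le_l1_cart[of v] by (simp add: sum_2)

text \<open>With a = \<open>xi e p\<close>, the absolute value of \<open>slope\<close> is at least
  |a| R >= a^2, because its bracket 3 a^2 + b^2 + 2 e^2 is at least R^2.\<close>

lemma abs_xi_le_1:
  assumes e: "e > 0" and p: "\<bar>p $ 1\<bar> \<le> 1"
  shows "\<bar>xi e p\<bar> \<le> 1"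
proof -
  define a R where "a = xi e p" and "R = rad e a (p $ 2)"
  have R: "R > 0" using rad_pos[OF e] by (simp add: R_def)
  have "\<bar>a\<bar> * \<bar>a\<bar> \<le> \<bar>a\<bar> * R"
    using rad_bounds(1)[OF e, of a "p $ 2"] by (intro mult_left_mono) (auto simp: R_def)
  also have "\<dots> = \<bar>a\<bar> * R\<^sup>2 / R" using R by (simp add: power2_eq_square)
  also have "\<dots> \<le> \<bar>a\<bar> * (3 * a\<^sup>2 + (p $ 2)\<^sup>2 + 2 * e\<^sup>2) / R"
    using R by (intro divide_right_mono mult_left_mono) (auto simp: R_def rad_squared)
  also have "\<dots> = \<bar>p $ 1\<bar>"
    unfolding slope_xi[OF e, of p, symmetric] using R
    by (simp add: slope_def a_def R_def abs_mult)
  finally have "\<bar>a\<bar>\<^sup>2 \<le> 1" using p by (simp add: power2_eq_square)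
  then show ?thesis by (simp add: a_def abs_square_le_1)
qed

text \<open>On the unit square the radius is at most 2 for e <= 1, so \<open>slope_d1\<close> <= 12
  and \<open>slope_d2\<close> is at most 2 in absolute value. This controls distances in x by
  distances in \<open>xi\<close> and y, uniformly in \<open>e\<close>.\<close>

lemma slope_lipschitz_unit_square:
  assumes e: "0 < e" "e \<le> 1"
    and ab: "\<bar>a\<bar> \<le> 1" "\<bar>a'\<bar> \<le> 1" "\<bar>b\<bar> \<le> 1" "\<bar>b'\<bar> \<le> 1"
  shows "\<bar>slope e a b - slope e a' b'\<bar> \<le> 12 * \<bar>a - a'\<bar> + 2 * \<bar>b - b'\<bar>"
proof -
  have rad: "rad e x y \<le> 2" if "x \<in> {-1..1}" "y \<in> {-1..1}" for x y
  proof -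
    have "x\<^sup>2 \<le> 1" "y\<^sup>2 \<le> 1" "e\<^sup>2 \<le> 1"
      using that e by (auto simp: abs_square_le_1)
    then show ?thesis by (auto simp: rad_def intro!: real_le_lsqrt)
  qed
  have "norm (slope e a b - slope e a' b) \<le> 12 * norm (a - a')"
  proof (rule field_differentiable_bound[where S = "{-1..1}" and f' = "\<lambda>x. slope_d1 e x b"])
    fix x :: real assume x: "x \<in> {-1..1}"
    show "((\<lambda>x. slope e x b) has_field_derivative slope_d1 e x b) (at x within {-1..1})"
      by (rule has_field_derivative_at_within[OF DERIV_slope_1[OF e(1)]])
    show "norm (slope_d1 e x b) \<le> 12"
      using slope_d1_bounds[OF e(1), of x b] slope_d1_pos[OF e(1), of x b] rad[OF x, of b] ab
      unfolding real_norm_def atLeastAtMost_iff abs_le_iff by linarith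
  qed (use ab in auto)
  moreover have "norm (slope e a' b - slope e a' b') \<le> 2 * norm (b - b')"
  proof (rule field_differentiable_bound[where S = "{-1..1}" and f' = "\<lambda>x. slope_d2 e a' x"])
    fix x :: real assume x: "x \<in> {-1..1}"
    show "(slope e a' has_field_derivative slope_d2 e a' x) (at x within {-1..1})"
      by (rule has_field_derivative_at_within[OF DERIV_slope_2[OF e(1)]])
    show "norm (slope_d2 e a' x) \<le> 2"
      using abs_slope_d2_le[OF e(1), of a' x] rad[OF _ x, of a'] ab
      unfolding real_norm_def atLeastAtMost_iff abs_le_iff by linarith
  qed (use ab in auto)
  ultimately show ?thesis by simp
qed

lemma cube_sum_le:
  fixes s t :: real
  assumes "s \<ge> 0" "t \<ge> 0"
  shows "(s + t) ^ 3 \<le> 4 * (s ^ 3 + t ^ 3)"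
proof -
  have "4 * (s ^ 3 + t ^ 3) - (s + t) ^ 3 = 3 * (s + t) * (s - t)\<^sup>2"
    by (simp add: power2_eq_square power3_eq_cube algebra_simps)
  moreover have "\<dots> \<ge> 0" using assms by simp
  ultimately show ?thesis by linarith
qed

lemma convexity_modulus_cubic: "convexity_modulus (\<lambda>t. t ^ 3 / 100000)"
  by (auto simp: convexity_modulus_def intro!: mono_onI divide_right_mono power_mono)

lemma potential_convexity_modulus:
  assumes e: "0 < e" "e \<le> 1"
  shows "has_convexity_modulus (potential e) (\<lambda>t. t ^ 3 / 100000)"
  unfolding has_convexity_modulus_def
proof (intro ballI impI)
  fix p q :: "real^2"
  assume pq: "p \<in> ball 0 1" "q \<in> ball 0 1"
  have abs1: "\<bar>r $ i\<bar> \<le> 1" if "r \<in> ball 0 1" for r :: "real^2" and i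
    using that component_le_norm_cart[of r i] by simp
  define s t where "s = \<bar>xi e q - xi e p\<bar>" and "t = \<bar>q $ 2 - p $ 2\<bar>"
  have st: "s \<ge> 0" "t \<ge> 0" by (auto simp: s_def t_def)
  have "\<bar>q $ 1 - p $ 1\<bar> \<le> 12 * s + 2 * t"
    unfolding s_def t_def
    using slope_lipschitz_unit_square[OF e abs_xi_le_1[OF e(1)] abs_xi_le_1[OF e(1)], of q p "q $ 2" "p $ 2"]
      slope_xi[OF e(1)] pq abs1 by simp
  then have "norm (q - p) \<le> 12 * (s + t)"
    using norm_le_abs_2[of "q - p"] st(2) by (simp add: t_def[symmetric])
  then have "norm (q - p) ^ 3 \<le> (12 * (s + t)) ^ 3"
    by (intro power_mono) auto
  also have "\<dots> = 1728 * (s + t) ^ 3" unfolding power_mult_distrib by simp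
  also have "\<dots> \<le> 1728 * (4 * (s ^ 3 + t ^ 3))"
    using cube_sum_le[OF st] by simp
  finally have "norm (q - p) ^ 3 \<le> 6912 * s ^ 3 + 6912 * t ^ 3" by simp
  moreover have "0 \<le> s ^ 3" "0 \<le> t ^ 3" using st by simp_all
  \<comment> \<open>The factor needed is 12 * 6912 = 82944, rounded up in the modulus.\<close>
  ultimately have "norm (q - p) ^ 3 / 100000 \<le> (s ^ 3 + t ^ 3) / 12"
    unfolding add_divide_distrib by linarith
  then show "potential e p + gradient (potential e) p \<bullet> (q - p) + norm (q - p) ^ 3 / 100000 \<le> potential e q"
    using potential_bregman[OF e(1), of p q] unfolding s_def t_def by linarith
qed

section \<open>Lipschitz bounds for the second derivatives\<close>

text \<open>The factor \<open>1 / e\<^sup>2\<close> is the reciprocal of the shortest length scale of the potential.\<close>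

definition lip_family :: "real set \<Rightarrow> (real^2) set \<Rightarrow> (real \<Rightarrow> real^2 \<Rightarrow> real) \<Rightarrow> bool" where
  "lip_family I S h \<longleftrightarrow> (\<exists>B L. 0 \<le> B \<and> 0 \<le> L \<and>
     (\<forall>e\<in>I. \<forall>p\<in>S. \<bar>h e p\<bar> \<le> B \<and> (\<forall>q\<in>S. \<bar>h e p - h e q\<bar> \<le> L * (norm (p - q) / e\<^sup>2))))"

lemma lip_familyI:
  assumes "0 \<le> B" "0 \<le> L" "\<And>e p. e \<in> I \<Longrightarrow> p \<in> S \<Longrightarrow> \<bar>h e p\<bar> \<le> B"
    "\<And>e p q. e \<in> I \<Longrightarrow> p \<in> S \<Longrightarrow> q \<in> S \<Longrightarrow> \<bar>h e p - h e q\<bar> \<le> L * (norm (p - q) / e\<^sup>2)"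
  shows "lip_family I S h"
  unfolding lip_family_def using assms by blast

lemma lip_familyE:
  assumes "lip_family I S h"
  obtains B L where "0 \<le> B" "0 \<le> L" "\<And>e p. e \<in> I \<Longrightarrow> p \<in> S \<Longrightarrow> \<bar>h e p\<bar> \<le> B"
    "\<And>e p q. e \<in> I \<Longrightarrow> p \<in> S \<Longrightarrow> q \<in> S \<Longrightarrow> \<bar>h e p - h e q\<bar> \<le> L * (norm (p - q) / e\<^sup>2)"
  using assms unfolding lip_family_def by blast

lemma lip_family_cong:
  assumes "lip_family I S k" "\<And>e p. e \<in> I \<Longrightarrow> p \<in> S \<Longrightarrow> h e p = k e p"
  shows "lip_family I S h"
  using assms unfolding lip_family_def by simp

lemma lip_family_const: "lip_family I S (\<lambda>e p. c)"
  by (rule lip_familyI[of "\<bar>c\<bar>" 0]) auto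

lemma lip_family_add:
  assumes "lip_family I S h" "lip_family I S k"
  shows "lip_family I S (\<lambda>e p. h e p + k e p)"
proof -
  from assms(1) obtain B L where h: "0 \<le> B" "0 \<le> L" "\<And>e p. e \<in> I \<Longrightarrow> p \<in> S \<Longrightarrow> \<bar>h e p\<bar> \<le> B"
    "\<And>e p q. e \<in> I \<Longrightarrow> p \<in> S \<Longrightarrow> q \<in> S \<Longrightarrow> \<bar>h e p - h e q\<bar> \<le> L * (norm (p - q) / e\<^sup>2)"
    by (rule lip_familyE) blast
  from assms(2) obtain B' L' where k: "0 \<le> B'" "0 \<le> L'" "\<And>e p. e \<in> I \<Longrightarrow> p \<in> S \<Longrightarrow> \<bar>k e p\<bar> \<le> B'"
    "\<And>e p q. e \<in> I \<Longrightarrow> p \<in> S \<Longrightarrow> q \<in> S \<Longrightarrow> \<bar>k e p - k e q\<bar> \<le> L' * (norm (p - q) / e\<^sup>2)"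
    by (rule lip_familyE) blast
  show ?thesis
  proof (rule lip_familyI[of "B + B'" "L + L'"])
    fix e p q assume "e \<in> I" "p \<in> S" "q \<in> S"
    then show "\<bar>h e p + k e p - (h e q + k e q)\<bar> \<le> (L + L') * (norm (p - q) / e\<^sup>2)"
      using h(4)[of e p q] k(4)[of e p q] unfolding distrib_right by linarith
  next
    fix e p assume "e \<in> I" "p \<in> S"
    then show "\<bar>h e p + k e p\<bar> \<le> B + B'" using h(3)[of e p] k(3)[of e p] by linarith
  qed (use h k in auto)
qed

lemma lip_family_mult:
  assumes "lip_family I S h" "lip_family I S k"
  shows "lip_family I S (\<lambda>e p. h e p * k e p)"
proof -
  from assms(1) obtain B L where h: "0 \<le> B" "0 \<le> L" "\<And>e p. e \<in> I \<Longrightarrow> p \<in> S \<Longrightarrow> \<bar>h e p\<bar> \<le> B"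
    "\<And>e p q. e \<in> I \<Longrightarrow> p \<in> S \<Longrightarrow> q \<in> S \<Longrightarrow> \<bar>h e p - h e q\<bar> \<le> L * (norm (p - q) / e\<^sup>2)"
    by (rule lip_familyE) blast
  from assms(2) obtain B' L' where k: "0 \<le> B'" "0 \<le> L'" "\<And>e p. e \<in> I \<Longrightarrow> p \<in> S \<Longrightarrow> \<bar>k e p\<bar> \<le> B'"
    "\<And>e p q. e \<in> I \<Longrightarrow> p \<in> S \<Longrightarrow> q \<in> S \<Longrightarrow> \<bar>k e p - k e q\<bar> \<le> L' * (norm (p - q) / e\<^sup>2)"
    by (rule lip_familyE) blast
  show ?thesis
  proof (rule lip_familyI[of "B * B'" "B * L' + B' * L"])
    fix e p q assume *: "e \<in> I" "p \<in> S" "q \<in> S"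
    have "\<bar>h e p * k e p - h e q * k e q\<bar> = \<bar>h e p * (k e p - k e q) + k e q * (h e p - h e q)\<bar>"
      by (simp add: algebra_simps)
    also have "\<dots> \<le> \<bar>h e p\<bar> * \<bar>k e p - k e q\<bar> + \<bar>k e q\<bar> * \<bar>h e p - h e q\<bar>"
      by (metis abs_mult abs_triangle_ineq)
    also have "\<dots> \<le> B * (L' * (norm (p - q) / e\<^sup>2)) + B' * (L * (norm (p - q) / e\<^sup>2))"
      using * h k by (intro add_mono mult_mono) auto
    finally show "\<bar>h e p * k e p - h e q * k e q\<bar> \<le> (B * L' + B' * L) * (norm (p - q) / e\<^sup>2)"
      by (simp only: distrib_right mult.assoc)
  next
    fix e p assume *: "e \<in> I" "p \<in> S"
    then show "\<bar>h e p * k e p\<bar> \<le> B * B'"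
      unfolding abs_mult using h k by (intro mult_mono) auto
  qed (use h k in auto)
qed

lemma lip_family_diff:
  assumes "lip_family I S h" "lip_family I S k"
  shows "lip_family I S (\<lambda>e p. h e p - k e p)"
  by (rule lip_family_cong[OF lip_family_add[OF assms(1) lip_family_mult[OF lip_family_const[of _ _ "-1"] assms(2)]]])
    simp

text \<open>The difference of reciprocals is the difference divided by a product that is at least 1,
  so the Lipschitz constant does not change.\<close>

lemma lip_family_inverse:
  assumes "lip_family I S h" and ge: "\<And>e p. e \<in> I \<Longrightarrow> p \<in> S \<Longrightarrow> 1 \<le> h e p"
  shows "lip_family I S (\<lambda>e p. inverse (h e p))"
proof -
  from assms(1) obtain B L where h: "0 \<le> B" "0 \<le> L" "\<And>e p. e \<in> I \<Longrightarrow> p \<in> S \<Longrightarrow> \<bar>h e p\<bar> \<le> B"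
    "\<And>e p q. e \<in> I \<Longrightarrow> p \<in> S \<Longrightarrow> q \<in> S \<Longrightarrow> \<bar>h e p - h e q\<bar> \<le> L * (norm (p - q) / e\<^sup>2)"
    by (rule lip_familyE) blast
  show ?thesis
  proof (rule lip_familyI[of 1 L])
    fix e p q assume *: "e \<in> I" "p \<in> S" "q \<in> S"
    have 1: "1 \<le> h e p" "1 \<le> h e q" using * ge by auto
    then have "1 * 1 \<le> h e p * h e q" by (intro mult_mono) auto
    moreover have "\<bar>inverse (h e p) - inverse (h e q)\<bar> = \<bar>h e p - h e q\<bar> / (h e p * h e q)"
      using 1 by (auto simp: field_simps abs_divide abs_minus_commute)
    ultimately have "\<bar>inverse (h e p) - inverse (h e q)\<bar> \<le> \<bar>h e p - h e q\<bar>"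
      using mult_left_mono[of 1 "h e p * h e q" "\<bar>h e p - h e q\<bar>"] by (simp add: divide_le_eq)
    then show "\<bar>inverse (h e p) - inverse (h e q)\<bar> \<le> L * (norm (p - q) / e\<^sup>2)"
      using h(4)[OF *] by linarith
  next
    fix e p assume "e \<in> I" "p \<in> S"
    then show "\<bar>inverse (h e p)\<bar> \<le> 1" using ge[of e p] by (simp add: inverse_le_1_iff)
  qed (use h in auto)
qed

lemmas lip_family_intros =
  lip_family_const lip_family_add lip_family_diff lip_family_mult

text \<open>\<open>rad\<close> is the Euclidean norm of the triple (a, b, e).\<close>

lemma rad_lipschitz: "\<bar>rad e a b - rad e a' b'\<bar> \<le> \<bar>a - a'\<bar> + \<bar>b - b'\<bar>"
proof -
  have r: "rad e a b = norm ((a, b), e)" for a b by (simp add: rad_def norm_prod_def)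
  have "\<bar>rad e a b - rad e a' b'\<bar> \<le> norm (((a, b), e) - ((a', b'), e))"
    unfolding r by (rule norm_triangle_ineq3)
  also have "\<dots> \<le> norm (a - a') + norm (b - b')"
    using norm_Pair_le[of "a - a'" "b - b'"] by (simp add: norm_prod_def)
  finally show ?thesis by simp
qed

abbreviation prad :: "real \<Rightarrow> real^2 \<Rightarrow> real" where
  "prad e p \<equiv> rad e (xi e p) (p $ 2)"

lemma
  assumes e: "0 < e" "e \<le> 1"
  shows xi_lipschitz': "\<bar>xi e p - xi e q\<bar> \<le> 2 * (norm (p - q) / e)"
    and prad_lipschitz: "\<bar>prad e p - prad e q\<bar> \<le> 3 * (norm (p - q) / e)"
    and nth_lipschitz: "\<bar>p $ 2 - q $ 2\<bar> \<le> norm (p - q) / e"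
proof -
  have n: "norm (p - q) \<le> norm (p - q) / e"
    using e by (simp add: le_divide_eq mult_left_le)
  then show 1: "\<bar>xi e p - xi e q\<bar> \<le> 2 * (norm (p - q) / e)"
    using xi_lipschitz[OF e(1), of p q] by (simp add: distrib_right)
  show 2: "\<bar>p $ 2 - q $ 2\<bar> \<le> norm (p - q) / e"
    using component_le_norm_cart[of "p - q" 2] n by simp
  show "\<bar>prad e p - prad e q\<bar> \<le> 3 * (norm (p - q) / e)"
    using rad_lipschitz[of e "xi e p" "p $ 2" "xi e q" "q $ 2"] 1 2 by linarith
qed

text \<open>Numerator and radius vary at rate 1/e, and division by a radius of at least
  \<open>e\<close> costs another factor 1/e. The quotient itself is at most 1, so the constants 2
  and 3 add up to 5.\<close>

lemma lip_family_over_rad: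
  assumes I: "I \<subseteq> {0<..1}"
    and c: "\<And>e p. e \<in> I \<Longrightarrow> \<bar>c e p\<bar> \<le> prad e p"
    and l: "\<And>e p q. e \<in> I \<Longrightarrow> \<bar>c e p - c e q\<bar> \<le> 2 * (norm (p - q) / e)"
  shows "lip_family I S (\<lambda>e p. c e p / prad e p)"
proof (rule lip_familyI[of 1 5])
  fix e p q assume eI: "e \<in> I"
  then have e: "0 < e" "e \<le> 1" using I by auto
  let ?R = "prad e p" and ?R' = "prad e q"
  have R: "?R > 0" "?R' > 0" "e \<le> ?R"
    using rad_pos[OF e(1)] rad_bounds(3)[OF e(1)] by auto
  have "c e p / ?R - c e q / ?R' = (c e p - c e q) / ?R + c e q / ?R' * ((?R' - ?R) / ?R)"
    using R by (simp add: field_simps)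
  then have "\<bar>c e p / ?R - c e q / ?R'\<bar> \<le> \<bar>c e p - c e q\<bar> / ?R + \<bar>c e q / ?R'\<bar> * (\<bar>?R' - ?R\<bar> / ?R)"
    using R abs_triangle_ineq[of "(c e p - c e q) / ?R" "c e q / ?R' * ((?R' - ?R) / ?R)"]
    by (simp add: abs_mult abs_divide)
  also have "\<dots> \<le> (2 * (norm (p - q) / e)) / e + 1 * ((3 * (norm (p - q) / e)) / e)"
  proof (rule add_mono)
    show "\<bar>c e p - c e q\<bar> / ?R \<le> (2 * (norm (p - q) / e)) / e"
      by (rule frac_le) (use R e l[OF eI, of p q] in auto)
    show "\<bar>c e q / ?R'\<bar> * (\<bar>?R' - ?R\<bar> / ?R) \<le> 1 * ((3 * (norm (p - q) / e)) / e)"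
    proof (rule mult_mono)
      show "\<bar>c e q / ?R'\<bar> \<le> 1" using R c[OF eI, of q] by simp
      have "\<bar>?R' - ?R\<bar> \<le> 3 * (norm (p - q) / e)"
        using prad_lipschitz[OF e, of p q] by (simp only: abs_minus_commute)
      then show "\<bar>?R' - ?R\<bar> / ?R \<le> (3 * (norm (p - q) / e)) / e"
        by (rule frac_le[rotated]) (use R e in auto)
    qed (use R in auto)
  qed
  also have "\<dots> = 5 * (norm (p - q) / e\<^sup>2)"
    by (simp add: power2_eq_square)
  finally show "\<bar>c e p / ?R - c e q / ?R'\<bar> \<le> 5 * (norm (p - q) / e\<^sup>2)" .
next
  fix e p assume eI: "e \<in> I"
  then show "\<bar>c e p / prad e p\<bar> \<le> 1"
    using c[OF eI, of p] rad_pos[of e "xi e p" "p $ 2"] I by auto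
qed auto

text \<open>Coordinates on the unit sphere, in which the second derivatives are polynomials or their
  reciprocals times powers of the radius; this makes their Lipschitz bounds a matter of closure rules.\<close>

abbreviation nxi :: "real \<Rightarrow> real^2 \<Rightarrow> real" where "nxi e p \<equiv> xi e p / prad e p"
abbreviation ny :: "real \<Rightarrow> real^2 \<Rightarrow> real" where "ny e p \<equiv> p $ 2 / prad e p"
abbreviation ne :: "real \<Rightarrow> real^2 \<Rightarrow> real" where "ne e p \<equiv> e / prad e p"

lemma lip_family_normalized:
  assumes I: "I \<subseteq> {0<..1}"
  shows "lip_family I S nxi" "lip_family I S ny" "lip_family I S ne"
proof -
  have e: "0 < e" "e \<le> 1" if "e \<in> I" for e using that I by auto
  show "lip_family I S nxi"
    by (rule lip_family_over_rad[OF I rad_bounds(1)[OF e(1)] xi_lipschitz'[OF e]])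
  have "\<bar>p $ 2 - q $ 2\<bar> \<le> 2 * (norm (p - q) / e)" if "e \<in> I" for e and p q :: "real^2"
  proof -
    have "0 \<le> norm (p - q) / e" using e[OF that] by simp
    then show ?thesis using nth_lipschitz[OF e[OF that], of p q] by linarith
  qed
  then show "lip_family I S ny"
    by (intro lip_family_over_rad[OF I rad_bounds(2)[OF e(1)]])
  show "lip_family I S ne"
  proof (rule lip_family_over_rad[OF I])
    fix e p q assume "e \<in> I"
    from e[OF this] show "\<bar>e\<bar> \<le> prad e p" "\<bar>e - e\<bar> \<le> 2 * (norm (p - q) / e)"
      using rad_bounds(3)[of e "xi e p" "p $ 2"] by auto
  qed
qed

lemma slope_num_scale:
  assumes "R \<noteq> 0"
  shows "slope_num (e / R) (a / R) (b / R) = slope_num e a b / R ^ 4"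
  using assms by (simp add: slope_num_def power_divide add_divide_distrib distrib_left power_mult[symmetric])

text \<open>\<open>slope_num\<close> is homogeneous of degree 4 in (e, a, b), so
  \<open>slope_d1\<close> has degree 1 and equals the radius times \<open>slope_num\<close> at the
  normalized point. There the lower bound of \<open>slope_num_bounds\<close> becomes 1.\<close>

lemma slope_num_normalized:
  assumes e: "e > 0"
  shows "slope_d1 e (xi e p) (p $ 2) = prad e p * slope_num (ne e p) (nxi e p) (ny e p)"
    "slope_d1 e (p $ 2) (xi e p) = prad e p * slope_num (ne e p) (ny e p) (nxi e p)"
    "1 \<le> slope_num (ne e p) (nxi e p) (ny e p)"
proof -
  have R: "prad e p > 0" "prad e p \<noteq> 0" "prad e p ^ 4 > 0"
    using rad_pos[OF e, of "xi e p" "p $ 2"] by simp_all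
  have *: "x / prad e p ^ 3 = prad e p * (x / prad e p ^ 4)" for x
    using R(2) by (simp add: power_numeral_reduce)
  show "slope_d1 e (xi e p) (p $ 2) = prad e p * slope_num (ne e p) (nxi e p) (ny e p)"
    unfolding slope_num_scale[OF R(2)] slope_d1_def by (rule * )
  show "slope_d1 e (p $ 2) (xi e p) = prad e p * slope_num (ne e p) (ny e p) (nxi e p)"
    unfolding slope_num_scale[OF R(2)] slope_d1_def rad_commute[of e "p $ 2" "xi e p"] by (rule * )
  show "1 \<le> slope_num (ne e p) (nxi e p) (ny e p)"
    unfolding slope_num_scale[OF R(2)]
    using slope_num_bounds(1)[of e "xi e p" "p $ 2"] R(3) by (simp add: le_divide_eq)
qed

lemma slope_d2_normalized:
  assumes e: "e > 0"
  shows "slope_d2 e (xi e p) (p $ 2) =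
    prad e p * (nxi e p * ny e p * (ny e p * ny e p - nxi e p * nxi e p))"
proof -
  define a b R where "a = xi e p" and "b = p $ 2" and "R = prad e p"
  have "R \<noteq> 0" using rad_pos[OF e, of "xi e p" "p $ 2"] by (simp add: R_def)
  then have "a * b * (b\<^sup>2 - a\<^sup>2) / R ^ 3 = R * (a / R * (b / R) * (b / R * (b / R) - a / R * (a / R)))"
    by (simp add: field_simps power2_eq_square power3_eq_cube)
  then show ?thesis by (simp only: slope_d2_def a_def b_def R_def)
qed

lemma lip_family_slope_num:
  assumes I: "I \<subseteq> {0<..1}"
  shows "lip_family I S (\<lambda>e p. slope_num (ne e p) (nxi e p) (ny e p))"
    "lip_family I S (\<lambda>e p. slope_num (ne e p) (ny e p) (nxi e p))"
  unfolding slope_num_def power2_eq_square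
  by (intro lip_family_intros lip_family_normalized[OF I])+

lemma lip_family_inverse_slope_num:
  assumes I: "I \<subseteq> {0<..1}"
  shows "lip_family I S (\<lambda>e p. inverse (slope_num (ne e p) (nxi e p) (ny e p)))"
  using I by (intro lip_family_inverse lip_family_slope_num slope_num_normalized) auto

text \<open>The radius cancels from the quotient, so the constants are uniform in \<open>e\<close>
  and hold on the whole plane.\<close>

lemma lip_family_source: "lip_family {0<..1} UNIV source"
proof (rule lip_family_cong[OF lip_family_mult[OF lip_family_slope_num(2) lip_family_inverse_slope_num]])
  fix e :: real and p :: "real^2" assume "e \<in> {0<..1}"
  then have e: "e > 0" by simp
  show "source e p = slope_num (ne e p) (ny e p) (nxi e p) *
      inverse (slope_num (ne e p) (nxi e p) (ny e p))"
    using rad_pos[OF e, of "xi e p" "p $ 2"]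
    unfolding source_def slope_num_normalized(1,2)[OF e] by (simp add: divide_inverse)
qed auto

text \<open>Only one \<open>e\<close> and one ball are treated, because the constants may depend on
  both: one entry is of order 1/R and another can grow like R. This suffices for local Hoelder
  regularity.\<close>

lemma lip_family_hessian:
  assumes e: "0 < e" "e \<le> 1"
  shows "lip_family {e} (ball p\<^sub>0 R\<^sub>0) (\<lambda>e p. hessian (potential e) p $ i $ j)"
proof -
  let ?S = "ball p\<^sub>0 R\<^sub>0"
  have I: "{e} \<subseteq> {0<..1}" using e by auto
  have rad: "lip_family {e} ?S prad"
  proof (rule lip_familyI[of "prad e p\<^sub>0 + 3 * (\<bar>R\<^sub>0\<bar> / e)" 3])
    show "0 \<le> prad e p\<^sub>0 + 3 * (\<bar>R\<^sub>0\<bar> / e)"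
      using rad_pos[OF e(1), of "xi e p\<^sub>0" "p\<^sub>0 $ 2"] e by simp
    fix e' p assume *: "e' \<in> {e}" "p \<in> ?S"
    have "norm (p - p\<^sub>0) / e \<le> \<bar>R\<^sub>0\<bar> / e"
      using * e by (intro divide_right_mono) (auto simp: dist_norm norm_minus_commute)
    then show "\<bar>prad e' p\<bar> \<le> prad e p\<^sub>0 + 3 * (\<bar>R\<^sub>0\<bar> / e)"
      using * prad_lipschitz[OF e, of p p\<^sub>0] rad_pos[OF e(1), of "xi e p" "p $ 2"] by auto
    fix q assume "q \<in> ?S"
    have "norm (p - q) / e \<le> norm (p - q) / e\<^sup>2"
      using e by (intro divide_left_mono) (auto simp: power2_eq_square mult_left_le)
    then show "\<bar>prad e' p - prad e' q\<bar> \<le> 3 * (norm (p - q) / e'\<^sup>2)"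
      using * prad_lipschitz[OF e, of p q] by auto
  qed simp
  let ?N = "\<lambda>e p. slope_num (ne e p) (nxi e p) (ny e p)"
  let ?N' = "\<lambda>e p. slope_num (ne e p) (ny e p) (nxi e p)"
  let ?M = "\<lambda>e p. nxi e p * ny e p * (ny e p * ny e p - nxi e p * nxi e p)"
  note lips = lip_family_intros lip_family_normalized[OF I] lip_family_inverse_slope_num[OF I]
    lip_family_slope_num[OF I] rad
  have pos: "prad e p > 0" "?N e p > 0" for p
    using rad_pos[OF e(1)] slope_num_normalized(3)[OF e(1), of p] by auto
  \<comment> \<open>Writing 1/R as \<open>ne e' p * (1 / e)\<close> with \<open>e\<close> fixed
    brings this entry under the closure rules.\<close>
  have "lip_family {e} ?S (\<lambda>e' p. ne e' p * (1 / e) * inverse (?N e' p))"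
    by (intro lips)
  then have 11: "lip_family {e} ?S (\<lambda>e p. hessian (potential e) p $ 1 $ 1)"
    by (rule lip_family_cong)
      (use e pos in \<open>auto simp: hessian_potential slope_num_normalized divide_inverse\<close>)
  have "lip_family {e} ?S (\<lambda>e' p. (- 1) * ?M e' p * inverse (?N e' p))"
    by (intro lips)
  then have 12: "lip_family {e} ?S (\<lambda>e p. - slope_d2 e (xi e p) (p $ 2) / slope_d1 e (xi e p) (p $ 2))"
    apply (rule lip_family_cong)
    subgoal for e' p
      using e pos(1)[of p] pos(2)[of p] slope_d2_normalized[OF e(1), of p] slope_num_normalized(1)[OF e(1), of p]
      by (simp add: divide_inverse)
    done
  have "lip_family {e} ?S (\<lambda>e' p. prad e' p * (?N' e' p + ?M e' p * ?M e' p * inverse (?N e' p)))"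
    by (intro lips)
  then have 22: "lip_family {e} ?S (\<lambda>e p. hessian (potential e) p $ 2 $ 2)"
    apply (rule lip_family_cong)
    subgoal for e' p
      using e pos(1)[of p] pos(2)[of p] slope_d2_normalized[OF e(1), of p] slope_num_normalized(1,2)[OF e(1), of p]
      by (simp add: hessian_potential divide_inverse power2_eq_square distrib_left)
    done
  have "\<forall>i j. lip_family {e} ?S (\<lambda>e p. hessian (potential e) p $ i $ j)"
    unfolding forall_2 using 11 12 22
    by (auto intro: lip_family_cong[OF 12] simp: hessian_potential e)
  then show ?thesis by blast
qed

section \<open>Hoelder norms\<close>

text \<open>Interpolation at the length scale \<delta>: the bound \<open>D\<close> is used for
  distances n >= \<delta> and the Lipschitz bound below that.\<close>

lemma holder_quotient_le:
  fixes d n \<alpha> \<delta> D L :: real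
  assumes \<alpha>: "0 < \<alpha>" "\<alpha> < 1" and pos: "\<delta> > 0" "n > 0" "L \<ge> 0" "D \<ge> 0"
    and d: "d \<le> D" "d \<le> L * (n / \<delta>)"
  shows "d / n powr \<alpha> \<le> (D + L) * \<delta> powr (- \<alpha>)"
proof (cases "\<delta> \<le> n")
  case True
  have "d / n powr \<alpha> \<le> D / \<delta> powr \<alpha>"
    using True \<alpha> pos d by (intro frac_le powr_mono2) auto
  also have "\<dots> = D * \<delta> powr (- \<alpha>)" by (simp add: powr_minus_divide)
  also have "\<dots> \<le> (D + L) * \<delta> powr (- \<alpha>)" using pos by (intro mult_right_mono) auto
  finally show ?thesis .
next
  case False
  have "d / n powr \<alpha> \<le> L * (n / \<delta>) / n powr \<alpha>"
    using d by (intro divide_right_mono) auto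
  also have "\<dots> = L * (n powr (1 - \<alpha>) / \<delta>)"
    using pos by (simp add: powr_diff)
  also have "\<dots> \<le> L * (\<delta> powr (1 - \<alpha>) / \<delta>)"
    using False \<alpha> pos by (intro mult_left_mono divide_right_mono powr_mono2) auto
  also have "\<dots> = L * \<delta> powr (- \<alpha>)"
    using pos by (simp add: powr_diff powr_minus_divide)
  also have "\<dots> \<le> (D + L) * \<delta> powr (- \<alpha>)" using pos by (intro mult_right_mono) auto
  finally show ?thesis .
qed

lemma holder_quotients_le:
  fixes f :: "'a::real_normed_vector \<Rightarrow> 'b::real_normed_vector"
  assumes \<alpha>: "0 < \<alpha>" "\<alpha> < 1" and pos: "\<delta> > 0" "L \<ge> 0" "B \<ge> 0"
    and B: "\<And>x. x \<in> E \<Longrightarrow> norm (f x) \<le> B"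
    and L: "\<And>x y. x \<in> E \<Longrightarrow> y \<in> E \<Longrightarrow> norm (f x - f y) \<le> L * (norm (x - y) / \<delta>)"
    and s: "s \<in> holder_quotients \<alpha> E f"
  shows "s \<le> (2 * B + L) * \<delta> powr (- \<alpha>)"
proof -
  obtain x y where xy: "x \<in> E" "y \<in> E" "x \<noteq> y" and s: "s = norm (f x - f y) / norm (x - y) powr \<alpha>"
    using s unfolding holder_quotients_def by blast
  have "norm (f x - f y) \<le> 2 * B"
    using norm_triangle_ineq4[of "f x" "f y"] B[OF xy(1)] B[OF xy(2)] by linarith
  then show ?thesis
    unfolding s using \<alpha> pos xy L by (intro holder_quotient_le) auto
qed

lemma holder_onI:
  fixes f :: "'a::real_normed_vector \<Rightarrow> 'b::real_normed_vector"
  assumes "0 < \<alpha>" "\<alpha> < 1" "\<delta> > 0" "L \<ge> 0" "B \<ge> 0"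
    and "\<And>x. x \<in> E \<Longrightarrow> norm (f x) \<le> B"
    and "\<And>x y. x \<in> E \<Longrightarrow> y \<in> E \<Longrightarrow> norm (f x - f y) \<le> L * (norm (x - y) / \<delta>)"
  shows "holder_on \<alpha> E f"
  unfolding holder_on_def bdd_above_def
  using holder_quotients_le[OF assms] assms(6) by blast

text \<open>Two distinct points of \<open>E\<close> make both suprema range over nonempty sets, as
  the least upper bound rules require.\<close>

lemma holder_norm_le:
  fixes f :: "'a::real_normed_vector \<Rightarrow> 'b::real_normed_vector"
  assumes "0 < \<alpha>" "\<alpha> < 1" "\<delta> > 0" "L \<ge> 0" "B \<ge> 0"
    and "\<And>x. x \<in> E \<Longrightarrow> norm (f x) \<le> B"
    and "\<And>x y. x \<in> E \<Longrightarrow> y \<in> E \<Longrightarrow> norm (f x - f y) \<le> L * (norm (x - y) / \<delta>)"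
    and E: "x \<in> E" "y \<in> E" "x \<noteq> y"
  shows "holder_norm \<alpha> E f \<le> B + (2 * B + L) * \<delta> powr (- \<alpha>)"
  unfolding holder_norm_def
proof (rule add_mono)
  show "(SUP x\<in>E. norm (f x)) \<le> B"
    using assms(6) E by (intro cSUP_least) auto
  have "holder_quotients \<alpha> E f \<noteq> {}"
    using E unfolding holder_quotients_def by blast
  then show "Sup (holder_quotients \<alpha> E f) \<le> (2 * B + L) * \<delta> powr (- \<alpha>)"
    by (rule cSup_least) (rule holder_quotients_le[OF assms(1-7)])
qed

lemma holder_norm_ge:
  fixes f :: "'a::real_normed_vector \<Rightarrow> 'b::real_normed_vector"
  assumes f: "holder_on \<alpha> E f" and E: "x \<in> E" "y \<in> E" "x \<noteq> y"
  shows "norm (f x - f y) / norm (x - y) powr \<alpha> \<le> holder_norm \<alpha> E f"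
    and "norm (f x) \<le> holder_norm \<alpha> E f"
proof -
  have q: "norm (f x - f y) / norm (x - y) powr \<alpha> \<le> Sup (holder_quotients \<alpha> E f)"
    using f E by (intro cSup_upper) (auto simp: holder_on_def holder_quotients_def)
  have n: "norm (f x) \<le> (SUP x\<in>E. norm (f x))"
    using f E by (intro cSUP_upper) (auto simp: holder_on_def)
  have "0 \<le> norm (f x - f y) / norm (x - y) powr \<alpha>" by simp
  then show "norm (f x - f y) / norm (x - y) powr \<alpha> \<le> holder_norm \<alpha> E f"
    "norm (f x) \<le> holder_norm \<alpha> E f"
    using q n norm_ge_zero[of "f x"] unfolding holder_norm_def by linarith+
qed

lemma C_alpha_if_lip_family:
  assumes \<alpha>: "0 < \<alpha>" "\<alpha> < 1" and e: "e > 0" "e \<in> I"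
    and h: "\<And>p R. lip_family I (ball p R) h"
  shows "C_alpha \<alpha> (h e)"
  unfolding C_alpha_def
proof (intro allI impI)
  fix p R
  from h[of p R] obtain B L where B: "0 \<le> B" "0 \<le> L" "\<And>e q. e \<in> I \<Longrightarrow> q \<in> ball p R \<Longrightarrow> \<bar>h e q\<bar> \<le> B"
    "\<And>e q q'. e \<in> I \<Longrightarrow> q \<in> ball p R \<Longrightarrow> q' \<in> ball p R \<Longrightarrow> \<bar>h e q - h e q'\<bar> \<le> L * (norm (q - q') / e\<^sup>2)"
    by (rule lip_familyE) blast
  show "holder_on \<alpha> (ball p R) (h e)"
    by (rule holder_onI[OF \<alpha>, of "e\<^sup>2" L B]) (use B e in auto)
qed

lemma lip_family_subset: "lip_family I S h \<Longrightarrow> T \<subseteq> S \<Longrightarrow> lip_family I T h"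
  unfolding lip_family_def by (meson subsetD)

lemma C_alpha_source:
  assumes "0 < \<alpha>" "\<alpha> < 1" "0 < e" "e \<le> 1"
  shows "C_alpha \<alpha> (source e)"
  using assms by (intro C_alpha_if_lip_family[where I = "{0<..1}"] lip_family_subset[OF lip_family_source]) auto

text \<open>The Frobenius norm is at most the sum of the absolute values of the entries, so
  entrywise constants may be summed.\<close>

lemma holder_on_matrix:
  fixes H :: "'a::real_normed_vector \<Rightarrow> real^2^2"
  assumes \<alpha>: "0 < \<alpha>" "\<alpha> < 1" and d: "\<delta> > 0"
    and H: "\<And>i j. \<exists>B L. 0 \<le> B \<and> 0 \<le> L \<and> (\<forall>x\<in>E. \<bar>H x $ i $ j\<bar> \<le> B \<and>
      (\<forall>y\<in>E. \<bar>H x $ i $ j - H y $ i $ j\<bar> \<le> L * (norm (x - y) / \<delta>)))"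
  shows "holder_on \<alpha> E H"
proof -
  have norm_le: "norm A \<le> (\<Sum>i\<in>UNIV. \<Sum>j\<in>UNIV. \<bar>A $ i $ j\<bar>)" for A :: "real^2^2"
  proof -
    have "norm A \<le> (\<Sum>i\<in>UNIV. norm (A $ i))"
      unfolding norm_vec_def[of A] by (rule L2_set_le_sum) auto
    also have "\<dots> \<le> (\<Sum>i\<in>UNIV. \<Sum>j\<in>UNIV. \<bar>A $ i $ j\<bar>)"
      by (intro sum_mono norm_le_l1_cart)
    finally show ?thesis .
  qed
  from H obtain B L where BL: "0 \<le> B i j" "0 \<le> L i j" "x \<in> E \<Longrightarrow> \<bar>H x $ i $ j\<bar> \<le> B i j"
    "x \<in> E \<Longrightarrow> y \<in> E \<Longrightarrow> \<bar>H x $ i $ j - H y $ i $ j\<bar> \<le> L i j * (norm (x - y) / \<delta>)" for i j x y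
    by metis
  show ?thesis
  proof (rule holder_onI[OF \<alpha> d, of "\<Sum>i\<in>UNIV. \<Sum>j\<in>UNIV. L i j" "\<Sum>i\<in>UNIV. \<Sum>j\<in>UNIV. B i j"])
    show "0 \<le> (\<Sum>i\<in>UNIV. \<Sum>j\<in>UNIV. L i j)" "0 \<le> (\<Sum>i\<in>UNIV. \<Sum>j\<in>UNIV. B i j)"
      using BL by (intro sum_nonneg; simp)+
    show "norm (H x) \<le> (\<Sum>i\<in>UNIV. \<Sum>j\<in>UNIV. B i j)" if "x \<in> E" for x
      using that BL by (intro order_trans[OF norm_le] sum_mono) auto
    show "norm (H x - H y) \<le> (\<Sum>i\<in>UNIV. \<Sum>j\<in>UNIV. L i j) * (norm (x - y) / \<delta>)"
      if "x \<in> E" "y \<in> E" for x y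
      unfolding sum_distrib_right
      using that BL(4)[of x y] by (intro order_trans[OF norm_le] sum_mono) auto
  qed
qed

lemma C2_alpha_potential:
  assumes \<alpha>: "0 < \<alpha>" "\<alpha> < 1" and e: "0 < e" "e \<le> 1"
  shows "C2_alpha \<alpha> (potential e)"
  unfolding C2_alpha_def C_alpha_def
proof (intro conjI allI impI)
  show "potential e differentiable at p" for p
    using has_derivative_potential[OF e(1)] differentiableI by blast
  show "gradient (potential e) differentiable at p" for p
    using has_derivative_gradient_potential[OF e(1)] differentiableI by blast
  show "holder_on \<alpha> (ball p R) (hessian (potential e))" for p R
    using lip_family_hessian[OF e, of p R] e(1)
    by (intro holder_on_matrix[OF \<alpha>, of "e\<^sup>2"]) (auto simp: lip_family_def)
qed

section \<open>Two-sided norm estimates, with lower bounds from the origin and a probe point\<close>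

text \<open>The point with second coordinate 0 at which \<open>xi\<close> takes the value \<open>e\<close>.\<close>

definition probe :: "real \<Rightarrow> real^2" where
  "probe e = vector [slope e e 0, 0]"

lemma rad_diag: "e > 0 \<Longrightarrow> rad e e 0 = sqrt 2 * e" "e > 0 \<Longrightarrow> rad e 0 e = sqrt 2 * e"
  by (simp_all add: rad_def real_sqrt_mult flip: mult_2)

lemma rad_origin: "e > 0 \<Longrightarrow> rad e 0 0 = e"
  by (simp add: rad_def)

lemma probe_bounds:
  assumes e: "e > 0"
  shows "probe e \<noteq> 0" "norm (probe e) \<le> 4 * e\<^sup>2"
proof -
  have s: "slope e e 0 = 5 * e\<^sup>2 / sqrt 2"
    using e by (simp add: slope_def rad_diag field_simps power2_eq_square)
  have "5 / 4 \<le> sqrt 2" by (rule real_le_rsqrt) (simp add: power2_eq_square)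
  then have "5 * e\<^sup>2 / sqrt 2 \<le> 4 * e\<^sup>2"
    using e by (simp add: divide_le_eq)
  moreover have "0 < 5 * e\<^sup>2 / sqrt 2" using e by simp
  ultimately show "norm (probe e) \<le> 4 * e\<^sup>2" "probe e \<noteq> 0"
    using norm_le_abs_2[of "probe e"] s by (auto simp: probe_def vec_eq_iff forall_2)
qed

lemma xi_probe: "e > 0 \<Longrightarrow> xi e (probe e) = e" "e > 0 \<Longrightarrow> xi e 0 = 0"
  by (auto intro: xi_eqI simp: probe_def)

text \<open>By homogeneity the values 1 at the origin and 6/17 at the probe do not depend on
  \<open>e\<close>, although the two points are only of order e^2 apart.\<close>

lemma source_probe:
  assumes e: "e > 0"
  shows "source e 0 - source e (probe e) = 11 / 17"
proof -
  have "source e 0 = 1"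
    using slope_d1_pos[OF e, of 0 0] by (simp add: source_def xi_probe[OF e])
  moreover have "slope_num e 0 e = 6 * e ^ 4" "slope_num e e 0 = 17 * e ^ 4"
    by (simp_all add: slope_num_def power2_eq_square power_numeral_reduce algebra_simps)
  then have "source e (probe e) = 6 / 17"
    using e by (simp add: source_def xi_probe slope_d1_def rad_diag) (simp add: probe_def slope_d1_def rad_diag)
  ultimately show ?thesis by simp
qed

lemma hessian_probe:
  assumes e: "e > 0"
  shows "hessian (potential e) 0 $ 1 $ 1 = 1 / (2 * e)"
    "1 / (4 * e) \<le> hessian (potential e) 0 $ 1 $ 1 - hessian (potential e) (probe e) $ 1 $ 1"
proof -
  show 0: "hessian (potential e) 0 $ 1 $ 1 = 1 / (2 * e)"
    using e by (simp add: hessian_potential xi_probe slope_d1_def rad_origin slope_num_def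
        power2_eq_square power3_eq_cube)
  have "sqrt 2 \<le> 3 / 2" by (rule real_le_lsqrt) (auto simp: power2_eq_square)
  then have "2 * sqrt 2 / 17 \<le> (1 / 4 :: real)" by simp
  then have "2 * sqrt 2 / 17 * (1 / e) \<le> 1 / 4 * (1 / e)"
    using e by (intro mult_right_mono) auto
  moreover have "hessian (potential e) (probe e) $ 1 $ 1 = 2 * sqrt 2 / 17 * (1 / e)"
    using e by (simp add: hessian_potential xi_probe)
      (simp add: probe_def slope_d1_def rad_diag slope_num_def field_simps power2_eq_square power3_eq_cube)
  ultimately show "1 / (4 * e) \<le> hessian (potential e) 0 $ 1 $ 1 - hessian (potential e) (probe e) $ 1 $ 1"
    unfolding 0 by simp
qed

lemma probe_quotient_ge:
  fixes e \<alpha> d :: real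
  assumes \<alpha>: "0 < \<alpha>" "\<alpha> < 1" and e: "e > 0" and d: "d \<ge> 0"
  shows "d / 4 * e powr (- 2 * \<alpha>) \<le> d / norm (0 - probe e) powr \<alpha>"
proof -
  have pos: "norm (probe e) > 0" using probe_bounds(1)[OF e] by simp
  have "norm (probe e) powr \<alpha> \<le> (4 * e\<^sup>2) powr \<alpha>"
    using probe_bounds[OF e] \<alpha> by (intro powr_mono2) auto
  also have "\<dots> = 4 powr \<alpha> * e powr (2 * \<alpha>)"
    using e by (simp add: powr_mult powr_powr flip: powr_numeral)
  also have "\<dots> \<le> 4 * e powr (2 * \<alpha>)"
    using powr_mono[of \<alpha> 1 4] \<alpha> by (intro mult_right_mono) auto
  finally have "d / (4 * e powr (2 * \<alpha>)) \<le> d / norm (probe e) powr \<alpha>"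
    using d pos e by (intro divide_left_mono) auto
  then show ?thesis by (simp add: powr_minus_divide)
qed

lemma probe_in_ball: "0 < e \<Longrightarrow> e < 1 / 3 \<Longrightarrow> probe e \<in> ball 0 (1 / 2)"
proof -
  assume e: "0 < e" "e < 1 / 3"
  then have "e\<^sup>2 < (1 / 3)\<^sup>2" by (intro power_strict_mono) auto
  then show ?thesis using probe_bounds(2)[OF e(1)] by (simp add: power2_eq_square)
qed

text \<open>Interpolation at scale e^2. The constant is uniform in \<alpha> as well as in
  \<open>e\<close>, which the exponential family needs; the supremum part is absorbed since
  \<open>e powr (- 2 * \<alpha>)\<close> >= 1.\<close>

lemma holder_norm_source_upper:
  obtains K where "K > 0"
    "\<And>\<alpha> e. 0 < \<alpha> \<Longrightarrow> \<alpha> < 1 \<Longrightarrow> 0 < e \<Longrightarrow> e \<le> 1 \<Longrightarrow>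
       holder_norm \<alpha> (ball 0 1) (source e) \<le> K * e powr (- 2 * \<alpha>)"
proof -
  from lip_family_source obtain B L where B: "0 \<le> B" "0 \<le> L"
    "\<And>e p. e \<in> {0<..1} \<Longrightarrow> \<bar>source e p\<bar> \<le> B"
    "\<And>e p q. e \<in> {0<..1} \<Longrightarrow> \<bar>source e p - source e q\<bar> \<le> L * (norm (p - q) / e\<^sup>2)"
    by (rule lip_familyE) blast
  show ?thesis
  proof (rule that[of "3 * B + L + 1"])
    show "0 < 3 * B + L + 1" using B by simp
    fix \<alpha> e :: real assume \<alpha>: "0 < \<alpha>" "\<alpha> < 1" and e: "0 < e" "e \<le> 1"
    have "(0::real^2) \<in> ball 0 1" "(1 / 2) *\<^sub>R axis 1 1 \<in> (ball 0 1 :: (real^2) set)"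
      "(0::real^2) \<noteq> (1 / 2) *\<^sub>R axis 1 1"
      by (auto simp: axis_eq_0_iff norm_axis_1)
    then have "holder_norm \<alpha> (ball 0 1) (source e) \<le> B + (2 * B + L) * (e\<^sup>2) powr (- \<alpha>)"
      by (rule holder_norm_le[OF \<alpha>, rotated 5]) (use B e in auto)
    also have "(e\<^sup>2) powr (- \<alpha>) = e powr (- 2 * \<alpha>)"
      using e by (simp add: powr_powr flip: powr_numeral)
    also have "B + (2 * B + L) * e powr (- 2 * \<alpha>)
        \<le> B * e powr (- 2 * \<alpha>) + (2 * B + L) * e powr (- 2 * \<alpha>) + e powr (- 2 * \<alpha>)"
    proof -
      have "1 \<le> e powr (- 2 * \<alpha>)"
        using powr_mono'[of "- 2 * \<alpha>" 0 e] \<alpha> e by simp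
      then have "B * 1 \<le> B * e powr (- 2 * \<alpha>)" using B by (intro mult_left_mono)
      then show ?thesis using powr_ge_zero[of e "- 2 * \<alpha>"] by linarith
    qed
    also have "\<dots> = (3 * B + L + 1) * e powr (- 2 * \<alpha>)" by (simp add: algebra_simps)
    finally show "holder_norm \<alpha> (ball 0 1) (source e) \<le> (3 * B + L + 1) * e powr (- 2 * \<alpha>)" .
  qed
qed

lemma holder_norm_source_lower:
  assumes \<alpha>: "0 < \<alpha>" "\<alpha> < 1" and e: "0 < e" "e < 1 / 3"
  shows "1 / 8 * e powr (- 2 * \<alpha>) \<le> holder_norm \<alpha> (ball 0 1) (source e)"
proof -
  have h: "holder_on \<alpha> (ball 0 1) (source e)"
    using C_alpha_source[OF \<alpha>, of e] e by (simp add: C_alpha_def)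
  have "1 / 8 * e powr (- 2 * \<alpha>) \<le> 11 / 17 / 4 * e powr (- 2 * \<alpha>)"
    by (intro mult_right_mono) auto
  also have "\<dots> \<le> norm (source e 0 - source e (probe e)) / norm (0 - probe e) powr \<alpha>"
    unfolding source_probe[OF e(1)]
    using probe_quotient_ge[OF \<alpha> e(1), of "11 / 17"] by (simp only: real_norm_def abs_of_nonneg)
  also have "\<dots> \<le> holder_norm \<alpha> (ball 0 1) (source e)"
    using probe_in_ball[OF e] probe_bounds(1)[OF e(1)] by (intro holder_norm_ge[OF h]) auto
  finally show ?thesis .
qed

lemma matrix_component_le_norm: "\<bar>A $ i $ j\<bar> \<le> norm (A :: real^'n^'m)"
  using component_le_norm_cart[of "A $ i" j] Finite_Cartesian_Product.norm_nth_le[of A i] by linarith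

text \<open>The first bound is the difference quotient between the origin and the probe, used for
  the power law. The second is the size of the Hessian at the origin, used for the exponential
  law.\<close>

lemma holder_norm_hessian_lower:
  assumes \<alpha>: "0 < \<alpha>" "\<alpha> < 1" and e: "0 < e" "e < 1 / 3"
  shows "1 / 16 * e powr (- 1 - 2 * \<alpha>) \<le> holder_norm \<alpha> (ball 0 (1 / 2)) (hessian (potential e))"
    and "1 / (2 * e) \<le> holder_norm \<alpha> (ball 0 (1 / 2)) (hessian (potential e))"
proof -
  let ?H = "hessian (potential e)"
  have h: "holder_on \<alpha> (ball 0 (1 / 2)) ?H"
    using C2_alpha_potential[OF \<alpha>, of e] e by (simp add: C2_alpha_def C_alpha_def)
  note ge = holder_norm_ge[OF h _ probe_in_ball[OF e] probe_bounds(1)[OF e(1), symmetric], simplified]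
  have "1 / 16 * e powr (- 1 - 2 * \<alpha>) = 1 / (4 * e) / 4 * e powr (- 2 * \<alpha>)"
    using e by (simp add: powr_diff powr_minus_divide field_simps)
  also have "\<dots> \<le> 1 / (4 * e) / norm (0 - probe e) powr \<alpha>"
    using e by (intro probe_quotient_ge[OF \<alpha> e(1)]) auto
  also have "\<dots> \<le> norm (?H 0 - ?H (probe e)) / norm (0 - probe e) powr \<alpha>"
    using hessian_probe(2)[OF e(1)] matrix_component_le_norm[of "?H 0 - ?H (probe e)" 1 1]
    by (intro divide_right_mono) auto
  also have "\<dots> \<le> holder_norm \<alpha> (ball 0 (1 / 2)) ?H" using ge(1) by simp
  finally show "1 / 16 * e powr (- 1 - 2 * \<alpha>) \<le> holder_norm \<alpha> (ball 0 (1 / 2)) ?H" .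
  show "1 / (2 * e) \<le> holder_norm \<alpha> (ball 0 (1 / 2)) ?H"
    using hessian_probe(1)[OF e(1)] matrix_component_le_norm[of "?H 0" 1 1] ge(2) e(1) by simp
qed

section \<open>The two families of examples\<close>

lemma potential_admissible:
  assumes "0 < \<alpha>" "\<alpha> < 1" "0 < e" "e \<le> 1"
  shows "convex_on UNIV (potential e) \<and> C2_alpha \<alpha> (potential e) \<and> C_alpha \<alpha> (source e) \<and>
    has_convexity_modulus (potential e) (\<lambda>t. t ^ 3 / 100000) \<and>
    (\<forall>x. det (hessian (potential e) x) = source e x) \<and>
    (\<forall>x. 1 / 6 \<le> source e x \<and> source e x \<le> 6)"
  by (intro conjI allI convex_potential C2_alpha_potential C_alpha_source potential_convexity_modulus
      det_hessian_potential source_bounds assms)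

text \<open>The exponent \<rho> is the ratio (1 + 2 \<alpha>) / (2 \<alpha>) of the two blow-up
  rates.\<close>

lemma hessian_norm_ge_power:
  fixes \<alpha> :: real
  assumes \<alpha>: "0 < \<alpha>" "\<alpha> < 1"
  defines "\<rho> \<equiv> 1 + 1 / (2 * \<alpha>)"
  obtains c where "c > 0"
    "\<And>r. 0 < r \<Longrightarrow> r < 1 / 3 \<Longrightarrow> c * holder_norm \<alpha> (ball 0 1) (source r) powr \<rho>
      \<le> holder_norm \<alpha> (ball 0 (1 / 2)) (hessian (potential r))"
proof -
  obtain K where K: "K > 0" "\<And>\<alpha> e. 0 < \<alpha> \<Longrightarrow> \<alpha> < 1 \<Longrightarrow> 0 < e \<Longrightarrow> e \<le> 1 \<Longrightarrow>
       holder_norm \<alpha> (ball 0 1) (source e) \<le> K * e powr (- 2 * \<alpha>)"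
    using holder_norm_source_upper by blast
  \<comment> \<open>The constant cancels \<open>K powr \<rho>\<close> and leaves the factor 1/16 of
    \<open>holder_norm_hessian_lower\<close>.\<close>
  define c where "c = 1 / (16 * K powr \<rho>)"
  have \<rho>: "1 < \<rho>" and c: "c > 0" using \<alpha> K by (auto simp: \<rho>_def c_def)
  have bound: "c * holder_norm \<alpha> (ball 0 1) (source r) powr \<rho>
      \<le> holder_norm \<alpha> (ball 0 (1 / 2)) (hessian (potential r))" if r: "0 < r" "r < 1 / 3" for r
  proof -
    have nonneg: "0 \<le> holder_norm \<alpha> (ball 0 1) (source r)"
      by (rule order_trans[OF _ holder_norm_source_lower[OF \<alpha> r]]) simp
    have "holder_norm \<alpha> (ball 0 1) (source r) powr \<rho> \<le> (K * r powr (- 2 * \<alpha>)) powr \<rho>"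
      using K(2)[OF \<alpha>, of r] r \<rho> nonneg by (intro powr_mono2) auto
    also have "\<dots> = K powr \<rho> * r powr (- 2 * \<alpha> * \<rho>)"
      using K r by (simp add: powr_mult powr_powr)
    also have "- 2 * \<alpha> * \<rho> = - 1 - 2 * \<alpha>"
      using \<alpha> by (simp add: \<rho>_def field_simps)
    finally have "c * holder_norm \<alpha> (ball 0 1) (source r) powr \<rho>
        \<le> c * (K powr \<rho> * r powr (- 1 - 2 * \<alpha>))"
      using c by (intro mult_left_mono) auto
    also have "\<dots> = 1 / 16 * r powr (- 1 - 2 * \<alpha>)"
      using K by (simp add: c_def)
    also have "\<dots> \<le> holder_norm \<alpha> (ball 0 (1 / 2)) (hessian (potential r))"
      by (rule holder_norm_hessian_lower[OF \<alpha> r])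
    finally show ?thesis .
  qed
  from c bound show thesis by (rule that)
qed

lemma holder_norm_source_at_top:
  assumes \<alpha>: "0 < \<alpha>" "\<alpha> < 1"
  shows "filterlim (\<lambda>r. holder_norm \<alpha> (ball 0 1) (source r)) at_top (at_right 0)"
proof -
  have "filterlim (\<lambda>r::real. 1 / 8 * r powr (- 2 * \<alpha>)) at_top (at_right 0)"
  proof (rule filterlim_tendsto_pos_mult_at_top[OF tendsto_const])
    have "filterlim (\<lambda>r::real. exp (2 * \<alpha> * ln (inverse r))) at_top (at_right 0)"
      using \<alpha> by (intro filterlim_compose[OF exp_at_top] filterlim_tendsto_pos_mult_at_top[OF tendsto_const]
          filterlim_compose[OF ln_at_top filterlim_inverse_at_top_right]) simp
    then show "filterlim (\<lambda>r::real. r powr (- 2 * \<alpha>)) at_top (at_right 0)"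
      by (rule filterlim_mono_eventually)
        (auto simp: eventually_at_right_field powr_def ln_inverse intro!: exI[of _ 1])
  qed simp
  then show ?thesis
  proof (rule filterlim_at_top_mono)
    show "\<forall>\<^sub>F r in at_right 0. 1 / 8 * r powr (- 2 * \<alpha>) \<le> holder_norm \<alpha> (ball 0 1) (source r)"
      unfolding eventually_at_right_field
      by (rule exI[of _ "1 / 3"]) (auto intro: holder_norm_source_lower[OF \<alpha>, simplified])
  qed
qed

text \<open>For e = exp (-1/\<alpha>) the factor \<open>e powr (- 2 * \<alpha>)\<close> is the
  constant exp 2. On the other side 1/(2e) = exp (1/\<alpha>) / 2 is at least exp (1/(2\<alpha>)),
  since the latter is at least 2 for \<alpha> <= 1/2.\<close>

lemma exponential_hessian_norm:
  defines "r \<equiv> \<lambda>\<alpha>::real. exp (- 1 / \<alpha>)"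
  obtains C where "C > 0"
    "\<And>\<alpha>. 0 < \<alpha> \<Longrightarrow> \<alpha> \<le> 1 / 2 \<Longrightarrow> holder_norm \<alpha> (ball 0 1) (source (r \<alpha>)) \<le> C"
    "\<And>\<alpha>. 0 < \<alpha> \<Longrightarrow> \<alpha> \<le> 1 / 2 \<Longrightarrow>
      exp (1 / 2 / \<alpha>) \<le> holder_norm \<alpha> (ball 0 (1 / 2)) (hessian (potential (r \<alpha>)))"
proof -
  obtain K where K: "K > 0" "\<And>\<alpha> e. 0 < \<alpha> \<Longrightarrow> \<alpha> < 1 \<Longrightarrow> 0 < e \<Longrightarrow> e \<le> 1 \<Longrightarrow>
       holder_norm \<alpha> (ball 0 1) (source e) \<le> K * e powr (- 2 * \<alpha>)"
    using holder_norm_source_upper by blast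
  have main: "holder_norm \<alpha> (ball 0 1) (source (r \<alpha>)) \<le> K * exp 2 \<and>
      exp (1 / 2 / \<alpha>) \<le> holder_norm \<alpha> (ball 0 (1 / 2)) (hessian (potential (r \<alpha>)))" if \<alpha>: "0 < \<alpha>" "\<alpha> \<le> 1 / 2" for \<alpha>
  proof -
    have \<alpha>1: "\<alpha> < 1" using \<alpha> by simp
    have e2: "2 \<le> exp (1 / 2 / \<alpha>)"
    proof -
      have "1 \<le> 1 / 2 / \<alpha>" using \<alpha> by (simp add: le_divide_eq)
      then show ?thesis using exp_ge_add_one_self[of "1 / 2 / \<alpha>"] by linarith
    qed
    have half: "exp (1 / 2 / \<alpha>) * exp (1 / 2 / \<alpha>) = exp (1 / \<alpha>)"
      by (simp add: exp_add[symmetric])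
    have "2 * 2 \<le> exp (1 / 2 / \<alpha>) * exp (1 / 2 / \<alpha>)"
      using e2 by (intro mult_mono) auto
    then have "3 < exp (1 / \<alpha>)" unfolding half by simp
    then have r: "0 < r \<alpha>" "r \<alpha> < 1 / 3"
      by (simp_all add: r_def exp_minus inverse_eq_divide frac_less2)
    have "r \<alpha> powr (- 2 * \<alpha>) = exp 2"
      using \<alpha> by (simp add: r_def exp_powr_real)
    then have 1: "holder_norm \<alpha> (ball 0 1) (source (r \<alpha>)) \<le> K * exp 2"
      using K(2)[OF \<alpha>(1) \<alpha>1, of "r \<alpha>"] r by simp
    have "exp (1 / 2 / \<alpha>) * 2 \<le> exp (1 / 2 / \<alpha>) * exp (1 / 2 / \<alpha>)"
      using e2 by (intro mult_left_mono) auto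
    also have "\<dots> = 1 / r \<alpha>" unfolding half by (simp add: r_def exp_minus inverse_eq_divide)
    finally have "exp (1 / 2 / \<alpha>) \<le> 1 / (2 * r \<alpha>)" by simp
    also have "\<dots> \<le> holder_norm \<alpha> (ball 0 (1 / 2)) (hessian (potential (r \<alpha>)))"
      by (rule holder_norm_hessian_lower(2)[OF \<alpha>(1) \<alpha>1 r])
    finally show ?thesis using 1 by simp
  qed
  show thesis
    by (rule that[of "K * exp 2"]) (use K(1) main in auto)
qed

theorem theorem1p3:
  shows
    "(\<forall>\<alpha>::real. 0 < \<alpha> \<and> \<alpha> < 1 \<longrightarrow>
       (\<exists>(lam::real) (Lam::real) (c::real) (\<rho>::real) (m::real \<Rightarrow> real)
          (r\<^sub>0::real) (u::real \<Rightarrow> real^2 \<Rightarrow> real) (f::real \<Rightarrow> real^2 \<Rightarrow> real).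
          0 < lam \<and> lam \<le> Lam \<and> 0 < c \<and> 1 < \<rho> \<and> convexity_modulus m \<and> 0 < r\<^sub>0 \<and>
          (\<forall>r. 0 < r \<and> r < r\<^sub>0 \<longrightarrow>
             convex_on UNIV (u r) \<and> C2_alpha \<alpha> (u r) \<and> C_alpha \<alpha> (f r) \<and>
             has_convexity_modulus (u r) m \<and>
             (\<forall>x. det (hessian (u r) x) = f r x) \<and>
             (\<forall>x. lam \<le> f r x \<and> f r x \<le> Lam) \<and>
             holder_norm \<alpha> (ball 0 (1/2)) (hessian (u r))
               \<ge> c * holder_norm \<alpha> (ball 0 1) (f r) powr \<rho>) \<and>
          filterlim (\<lambda>r. holder_norm \<alpha> (ball 0 1) (f r)) at_top (at_right 0)))
     \<and>
     (\<exists>(lam::real) (Lam::real) (C::real) (c::real) (m::real \<Rightarrow> real)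
        (u::real \<Rightarrow> real^2 \<Rightarrow> real) (f::real \<Rightarrow> real^2 \<Rightarrow> real).
        0 < lam \<and> lam \<le> Lam \<and> 0 < C \<and> 0 < c \<and> convexity_modulus m \<and>
        (\<forall>\<alpha>. 0 < \<alpha> \<and> \<alpha> \<le> 1/2 \<longrightarrow>
           convex_on UNIV (u \<alpha>) \<and> C2_alpha \<alpha> (u \<alpha>) \<and> C_alpha \<alpha> (f \<alpha>) \<and>
           has_convexity_modulus (u \<alpha>) m \<and>
           (\<forall>x. det (hessian (u \<alpha>) x) = f \<alpha> x) \<and>
           (\<forall>x. lam \<le> f \<alpha> x \<and> f \<alpha> x \<le> Lam) \<and>
           holder_norm \<alpha> (ball 0 1) (f \<alpha>) \<le> C \<and>
           holder_norm \<alpha> (ball 0 (1/2)) (hessian (u \<alpha>)) \<ge> exp (c / \<alpha>)))"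
proof (intro conjI allI impI, goal_cases)
  case (1 \<alpha>)
  then have \<alpha>: "0 < \<alpha>" "\<alpha> < 1" by auto
  define \<rho> where "\<rho> = 1 + 1 / (2 * \<alpha>)"
  have \<rho>: "1 < \<rho>" using \<alpha> by (simp add: \<rho>_def)
  obtain c where c: "c > 0" and bound: "\<And>r. 0 < r \<Longrightarrow> r < 1 / 3 \<Longrightarrow>
      c * holder_norm \<alpha> (ball 0 1) (source r) powr \<rho>
      \<le> holder_norm \<alpha> (ball 0 (1 / 2)) (hessian (potential r))"
    using hessian_norm_ge_power[OF \<alpha>] unfolding \<rho>_def by metis
  note lim = holder_norm_source_at_top[OF \<alpha>]
  show ?case
  \<comment> \<open>The bounds 1/6 and 6 come from \<open>source_bounds\<close>; r < 1/3 keeps the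
    probe inside the ball of radius 1/2.\<close>
  proof (rule exI[of _ "1 / 6"], rule exI[of _ 6], rule exI[of _ c], rule exI[of _ \<rho>],
      rule exI[of _ "\<lambda>t. t ^ 3 / 100000"], rule exI[of _ "1 / 3"],
      rule exI[of _ potential], rule exI[of _ source], intro conjI allI impI)
    fix r :: real and x assume r: "0 < r \<and> r < 1 / 3"
    then have r': "0 < r" "r < 1 / 3" "r \<le> 1" by auto
    note adm = potential_admissible[OF \<alpha> r'(1,3)]
    from adm show "convex_on UNIV (potential r)" "C2_alpha \<alpha> (potential r)" "C_alpha \<alpha> (source r)"
      "has_convexity_modulus (potential r) (\<lambda>t. t ^ 3 / 100000)"
      "det (hessian (potential r) x) = source r x" "1 / 6 \<le> source r x" "source r x \<le> 6"
      by blast+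
    show "c * holder_norm \<alpha> (ball 0 1) (source r) powr \<rho>
        \<le> holder_norm \<alpha> (ball 0 (1 / 2)) (hessian (potential r))"
      by (rule bound[OF r'(1,2)])
  qed (use \<rho> c lim convexity_modulus_cubic in simp_all)
next
  case 2
  define r where "r = (\<lambda>\<alpha>::real. exp (- 1 / \<alpha>))"
  obtain C where C: "C > 0"
    "\<And>\<alpha>. 0 < \<alpha> \<Longrightarrow> \<alpha> \<le> 1 / 2 \<Longrightarrow> holder_norm \<alpha> (ball 0 1) (source (r \<alpha>)) \<le> C"
    "\<And>\<alpha>. 0 < \<alpha> \<Longrightarrow> \<alpha> \<le> 1 / 2 \<Longrightarrow>
      exp (1 / 2 / \<alpha>) \<le> holder_norm \<alpha> (ball 0 (1 / 2)) (hessian (potential (r \<alpha>)))"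
    using exponential_hessian_norm unfolding r_def by metis
  show ?case
  proof (rule exI[of _ "1 / 6"], rule exI[of _ 6], rule exI[of _ "C"], rule exI[of _ "1 / 2"],
      rule exI[of _ "\<lambda>t. t ^ 3 / 100000"], rule exI[of _ "\<lambda>\<alpha>. potential (r \<alpha>)"],
      rule exI[of _ "\<lambda>\<alpha>. source (r \<alpha>)"], intro conjI allI impI)
    fix \<alpha> :: real and x assume "0 < \<alpha> \<and> \<alpha> \<le> 1 / 2"
    then have \<alpha>: "0 < \<alpha>" "\<alpha> \<le> 1 / 2" "\<alpha> < 1" by auto
    have r: "0 < r \<alpha>" "r \<alpha> \<le> 1" using \<alpha> by (auto simp: r_def)
    note adm = potential_admissible[OF \<alpha>(1,3) r]
    from adm show "convex_on UNIV (potential (r \<alpha>))" "C2_alpha \<alpha> (potential (r \<alpha>))"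
      "C_alpha \<alpha> (source (r \<alpha>))" "has_convexity_modulus (potential (r \<alpha>)) (\<lambda>t. t ^ 3 / 100000)"
      "det (hessian (potential (r \<alpha>)) x) = source (r \<alpha>) x"
      "1 / 6 \<le> source (r \<alpha>) x" "source (r \<alpha>) x \<le> 6"
      by blast+
    from C(2,3)[OF \<alpha>(1,2)] show "holder_norm \<alpha> (ball 0 1) (source (r \<alpha>)) \<le> C"
      "exp (1 / 2 / \<alpha>) \<le> holder_norm \<alpha> (ball 0 (1 / 2)) (hessian (potential (r \<alpha>)))"
      by (simp_all add: r_def)
  qed (use C(1) convexity_modulus_cubic in simp_all)
qed

end
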